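(* For each $n \in \mathbb{N}$ let $p_n \in \mathbb{N}$ with $p_n \to \infty$ as $n \to \infty$, and let $x_1, \ldots, x_n$ be a random sample from $\mathcal{N}_{p_n}(\mu_n, \Sigma_n)$, where $\mu_n \in \mathbb{R}^{p_n}$ and $\Sigma_n \in \mathbb{R}^{p_n \times p_n}$ is positive definite. Let $d \geq 1$ be a fixed integer (not depending on $n$) and $\sigma^2 > 0$ a fixed constant, and assume that the eigenvalues of $\Sigma_n$ are $\lambda_{n1} \geq \cdots \geq \lambda_{nd} > \sigma^2 = \cdots = \sigma^2$ (i.e. the $p_n - d$ smallest eigenvalues all equal $\sigma^2$), with $\lambda_{nk} \to \infty$ as $n \to \infty$ for each $k = 1, \ldots, d$. Let $S_n$ be the sample covariance matrix, and for $k = 0, \ldots, p_n - 1$ define $$T_{n,k} := \frac{m_{2,p_n-k}(S_n)}{m_{1,p_n-k}(S_n)^2} - 1, \qquad g_{n,k} := (n-k-1)\,T_{n,k} - (p_n - k).$$ Suppose that, as $n \to \infty$, either (i) $p_n/n \to \gamma \in [0,\infty) \setminus \{1\}$ and $p_n/\lambda_{nd}^2 \to 0$, or (ii) $p_n/n \to \infty$, $p_n/(n\sqrt{\lambda_{nd}}) \to 0$ and $p_n/(\sqrt{n}\,\lambda_{nd}) \to 0$. Then for each $k = 0, \ldots, d-1$ and every $M > 0$, $$\mathbb{P}(g_{n,k}/n \leq M) \to 0 \quad \text{as } n \to \infty.$$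
   Context: For a symmetric $p \times p$ matrix $A$ with eigenvalues $\phi_1(A) \geq \cdots \geq \phi_p(A)$ and $1 \leq r \leq p$, $m_{\ell,r}(A) := \frac{1}{r}\sum_{i=p-r+1}^{p} \phi_i(A)^\ell$ denotes the $\ell$th sample moment of the $r$ smallest eigenvalues of $A$. The sample covariance matrix is $S_n = \frac{1}{n-1}\sum_{i=1}^n (x_i - \bar{x})(x_i - \bar{x})'$ with $\bar{x}$ the sample mean. *)

theory Defs
  imports "HOL-Probability.Probability" "Jordan_Normal_Form.Char_Poly"
    "Jordan_Normal_Form.Gauss_Jordan_Elimination"
begin

text \<open>Matrices are Jordan_Normal_Form matrices (type real mat); vectors of R^p are
  functions nat => real, of which only the coordinates 0..p-1 are relevant.\<close>

definition sym_mat :: "nat \<Rightarrow> real mat \<Rightarrow> bool" where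
  "sym_mat p A \<longleftrightarrow> A \<in> carrier_mat p p \<and> transpose_mat A = A"

definition pos_def_mat :: "nat \<Rightarrow> real mat \<Rightarrow> bool" where
  "pos_def_mat p A \<longleftrightarrow> sym_mat p A \<and>
     (\<forall>v::nat\<Rightarrow>real. (\<exists>i<p. v i \<noteq> 0) \<longrightarrow>
        (\<Sum>i<p. \<Sum>j<p. v i * A $$ (i,j) * v j) > 0)"

text \<open>Eigenvalues (with multiplicity) of a symmetric matrix, in decreasing order:
  list index i (0-based) holds phi_(i+1)(A).\<close>
definition eigvals_desc :: "real mat \<Rightarrow> real list" where
  "eigvals_desc A = (THE es. length es = dim_row A \<and> sorted_wrt (\<ge>) es \<and>
       char_poly A = (\<Prod>e\<leftarrow>es. [:- e, 1:]))"

definition moment_small :: "nat \<Rightarrow> nat \<Rightarrow> real mat \<Rightarrow> real" where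
  "moment_small l r A = (1 / real r) *
      (\<Sum>i\<in>{dim_row A - r..<dim_row A}. (eigvals_desc A ! i) ^ l)"

definition mvn_density :: "nat \<Rightarrow> (nat \<Rightarrow> real) \<Rightarrow> real mat \<Rightarrow> (nat \<Rightarrow> real) \<Rightarrow> real" where
  "mvn_density p mu Sig x =
     (let Q = the (mat_inverse Sig) in
      exp (- (1/2) * (\<Sum>i<p. \<Sum>j<p. (x i - mu i) * Q $$ (i,j) * (x j - mu j)))
      / sqrt ((2 * pi) ^ p * det Sig))"

definition mvn :: "nat \<Rightarrow> (nat \<Rightarrow> real) \<Rightarrow> real mat \<Rightarrow> (nat \<Rightarrow> real) measure" where
  "mvn p mu Sig = density (PiM {0..<p} (\<lambda>_. lborel))
       (\<lambda>x. ennreal (mvn_density p mu Sig x))"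

text \<open>Distribution of a random sample x_1,...,x_n (i.i.d.) from N_p(mu,Sig);
  a sample is X with X i = x_(i+1) for i < n.\<close>
definition sample_measure :: "nat \<Rightarrow> nat \<Rightarrow> (nat \<Rightarrow> real) \<Rightarrow> real mat
     \<Rightarrow> (nat \<Rightarrow> nat \<Rightarrow> real) measure" where
  "sample_measure n p mu Sig = PiM {0..<n} (\<lambda>_. mvn p mu Sig)"

definition sample_mean :: "nat \<Rightarrow> (nat \<Rightarrow> nat \<Rightarrow> real) \<Rightarrow> nat \<Rightarrow> real" where
  "sample_mean n X j = (1 / real n) * (\<Sum>i<n. X i j)"

definition sample_cov :: "nat \<Rightarrow> nat \<Rightarrow> (nat \<Rightarrow> nat \<Rightarrow> real) \<Rightarrow> real mat" where
  "sample_cov n p X = mat p p (\<lambda>(j,k). (1 / (real n - 1)) *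
      (\<Sum>i<n. (X i j - sample_mean n X j) * (X i k - sample_mean n X k)))"

definition T_stat :: "nat \<Rightarrow> nat \<Rightarrow> (nat \<Rightarrow> nat \<Rightarrow> real) \<Rightarrow> nat \<Rightarrow> real" where
  "T_stat n p X k = (let S = sample_cov n p X in
      moment_small 2 (p - k) S / (moment_small 1 (p - k) S) ^ 2 - 1)"

definition g_stat :: "nat \<Rightarrow> nat \<Rightarrow> (nat \<Rightarrow> nat \<Rightarrow> real) \<Rightarrow> nat \<Rightarrow> real" where
  "g_stat n p X k = (real n - real k - 1) * T_stat n p X k - (real p - real k)"

end

theory Submission
  imports Defs
begin

text \<open>
  Let \<open>\<phi>\<^sub>1 \<ge> \<phi>\<^sub>2 \<ge> \<dots>\<close> be the eigenvalues of the sample covariance matrix \<open>S\<close>. Two bounds hold with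
  probability close to one. First, \<open>\<phi>\<^sub>d \<ge> \<lambda>\<^sub>d / 2\<close>: on the span of the \<open>d\<close> spiked eigenvectors of \<open>\<Sigma>\<close>
  the form \<open>S\<close> is a rescaled \<open>d \<times> d\<close> empirical covariance of standard normals, which is close to
  the identity by Chebyshev, and the min-max principle applies. Second, the sum of the \<open>\<phi>\<^sub>i\<close> with
  \<open>i > d\<close> is at most the trace of \<open>S\<close> on the bulk eigenspace of \<open>\<Sigma>\<close> (Ky Fan), hence \<open>\<le> C p\<close> by
  Markov. By Cauchy-Schwarz these give
  \<open>T + 1 \<ge> (p - k) / d * (\<lambda>\<^sub>d / (\<lambda>\<^sub>d + 2 C p))\<^sup>2\<close> for \<open>k < d\<close>,
  and in both regimes the right-hand side dominates \<open>1 + p / n\<close>.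
\<close>

section \<open>Spectral theorem and variational bounds\<close>

text \<open>Three definitions shape the work. \<open>eigvals_desc\<close> is a definite description
  over factorisations of the characteristic polynomial, so it is usable only once the spectral
  theorem supplies a list and root multiplicities single it out. \<open>mvn\<close> is a density
  against product Lebesgue measure, so the law of a linear form needs a change of variables, made
  with a triangular factor of the inverse covariance. \<open>measure\<close> returns 0 on a
  non-measurable set, so the event must be proved measurable for the limit to mean anything; hence
  eigenvalues must be measurable functions of the sample.

  Second moments suffice because \<open>d\<close> is fixed: only \<open>d * d\<close> products and
  \<open>d\<close> means have to concentrate, and this fails with probability of order 1/n. The bulk
  is needed only up to a constant: for a target probability the Markov constant \<open>K\<close> is
  fixed before \<open>n\<close> grows. Up to constants, the bound for \<open>T + 1\<close> is the
  harmonic combination of \<open>p\<close> and \<open>\<lambda>\<^sub>d\<^sup>2 / p\<close>, which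
  is what both regimes control.\<close>

definition ip :: "nat \<Rightarrow> (nat \<Rightarrow> real) \<Rightarrow> (nat \<Rightarrow> real) \<Rightarrow> real" where
  "ip p x y = (\<Sum>i<p. x i * y i)"

definition mv :: "nat \<Rightarrow> (nat \<Rightarrow> nat \<Rightarrow> real) \<Rightarrow> (nat \<Rightarrow> real) \<Rightarrow> nat \<Rightarrow> real" where
  "mv p A x i = (\<Sum>j<p. A i j * x j)"

lemma ip_commute: "ip p x y = ip p y x"
  by (simp add: ip_def mult.commute)

lemma ip_add_right: "ip p x (\<lambda>i. y i + z i) = ip p x y + ip p x z"
  by (simp add: ip_def algebra_simps sum.distrib)

lemma ip_diff_right: "ip p x (\<lambda>i. y i - z i) = ip p x y - ip p x z"
  by (simp add: ip_def algebra_simps sum_subtractf)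

lemma ip_scale_right: "ip p x (\<lambda>i. c * y i) = c * ip p x y"
  by (simp add: ip_def algebra_simps sum_distrib_left)

lemma ip_add_left: "ip p (\<lambda>i. y i + z i) x = ip p y x + ip p z x"
  by (simp add: ip_def algebra_simps sum.distrib)

lemma ip_diff_left: "ip p (\<lambda>i. y i - z i) x = ip p y x - ip p z x"
  by (simp add: ip_def algebra_simps sum_subtractf)

lemma ip_scale_left: "ip p (\<lambda>i. c * y i) x = c * ip p y x"
  by (simp add: ip_def algebra_simps sum_distrib_left)

lemma ip_sum_right: "ip p x (\<lambda>i. \<Sum>k\<in>K. f k i) = (\<Sum>k\<in>K. ip p x (f k))"
  by (simp add: ip_def sum_distrib_left) (rule sum.swap)

lemma ip_sum_left: "ip p (\<lambda>i. \<Sum>k\<in>K. f k i) x = (\<Sum>k\<in>K. ip p (f k) x)"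
  by (simp add: ip_commute[of p _ x] ip_sum_right)

lemmas ip_linear = ip_add_left ip_add_right ip_diff_left ip_diff_right ip_scale_left ip_scale_right

lemma ip_cong:
  "(\<And>i. i < p \<Longrightarrow> x i = x' i) \<Longrightarrow> (\<And>i. i < p \<Longrightarrow> y i = y' i) \<Longrightarrow> ip p x y = ip p x' y'"
  by (simp add: ip_def)

lemma ip_self_nonneg: "0 \<le> ip p x x"
  by (simp add: ip_def sum_nonneg)

lemma ip_self_eq_0_iff: "ip p x x = 0 \<longleftrightarrow> (\<forall>i<p. x i = 0)"
  by (auto simp: ip_def sum_nonneg_eq_0_iff)

lemma mv_cong: "(\<And>i. i < p \<Longrightarrow> x i = y i) \<Longrightarrow> mv p A x = mv p A y"
  by (simp add: mv_def fun_eq_iff)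

lemma mv_add: "mv p A (\<lambda>i. x i + y i) = (\<lambda>i. mv p A x i + mv p A y i)"
  by (simp add: mv_def fun_eq_iff algebra_simps sum.distrib)

lemma mv_scale: "mv p A (\<lambda>i. c * x i) = (\<lambda>i. c * mv p A x i)"
  by (simp add: mv_def fun_eq_iff algebra_simps sum_distrib_left)

lemma ip_mv: "ip p x (mv p A y) = (\<Sum>i<p. \<Sum>j<p. x i * A i j * y j)"
  by (simp add: ip_def mv_def sum_distrib_left mult.assoc)

lemma ip_mv_sym:
  assumes "\<And>i j. i < p \<Longrightarrow> j < p \<Longrightarrow> A i j = A j i"
  shows "ip p x (mv p A y) = ip p (mv p A x) y"
proof -
  have "ip p x (mv p A y) = (\<Sum>i<p. \<Sum>j<p. y j * A j i * x i)"
    unfolding ip_mv by (intro sum.cong refl) (use assms in auto)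
  also have "\<dots> = ip p y (mv p A x)"
    unfolding ip_mv by (rule sum.swap)
  finally show ?thesis by (simp add: ip_commute)
qed

text \<open>Fewer than \<open>p\<close> linear conditions in \<open>p\<close> unknowns. Padding the
  coefficient rows with zero rows gives a square matrix; its transpose kills the unit vector of
  index \<open>m\<close>, so the determinant vanishes and the kernel is nontrivial.\<close>

lemma exists_orthogonal_vector:
  assumes "m < p"
  shows "\<exists>x. (\<exists>i<p. x i \<noteq> 0) \<and> (\<forall>j<m. ip p (u j) x = 0)"
proof -
  define A :: "real mat" where "A = mat p p (\<lambda>(i,j). if i < m then u i j else 0)"
  have A: "A \<in> carrier_mat p p" by (simp add: A_def)
  have "transpose_mat A *\<^sub>v unit_vec p m = 0\<^sub>v p"
    using assms by (intro eq_vecI) (auto simp: A_def scalar_prod_def unit_vec_def intro!: sum.neutral)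
  moreover have "unit_vec p m \<noteq> (0\<^sub>v p :: real vec)"
    using assms by (metis index_unit_vec(2) index_zero_vec(1) zero_neq_one)
  ultimately have "det (transpose_mat A) = 0"
    using A by (subst det_0_iff_vec_prod_zero[where n = p]) (auto intro!: exI[of _ "unit_vec p m"])
  hence "det A = 0" using A by (simp add: det_transpose)
  then obtain v where v: "v \<in> carrier_vec p" "v \<noteq> 0\<^sub>v p" "A *\<^sub>v v = 0\<^sub>v p"
    using det_0_iff_vec_prod_zero[OF A] by auto
  have "\<exists>i<p. v $ i \<noteq> 0"
    using v(1,2) by (metis carrier_vecD eq_vecI index_zero_vec(1) index_zero_vec(2))
  moreover have "ip p (u j) (\<lambda>i. v $ i) = 0" if "j < m" for j
  proof -
    have "(A *\<^sub>v v) $ j = 0" using v(3) that assms by simp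
    moreover have "(A *\<^sub>v v) $ j = (\<Sum>i<p. u j i * v $ i)"
      using that assms v(1) by (auto simp: A_def scalar_prod_def lessThan_atLeast0)
    ultimately show ?thesis by (simp add: ip_def)
  qed
  ultimately show ?thesis by blast
qed

section \<open>Eigenvectors by maximising the Rayleigh quotient\<close>

lemma continuous_on_ip [continuous_intros]:
  "continuous_on S f \<Longrightarrow> continuous_on S g \<Longrightarrow> continuous_on S (\<lambda>x. ip p (f x) (g x))"
  unfolding ip_def by (intro continuous_intros) (auto intro: continuous_on_product_then_coordinatewise)

lemma continuous_on_mv [continuous_intros]:
  assumes "continuous_on S f"
  shows "continuous_on S (\<lambda>x. mv p A (f x))"
proof (rule continuous_on_coordinatewise_then_product)
  show "continuous_on S (\<lambda>x. mv p A (f x) i)" for i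
    unfolding mv_def
    by (intro continuous_intros) (rule continuous_on_product_then_coordinatewise[OF assms])
qed

text \<open>The unit sphere of \<open>ip p\<close> is not compact in the function space, since
  coordinates from \<open>p\<close> on are free. Pinning them to 0 restores compactness by
  Tychonoff.\<close>

lemma compact_coordinate_box:
  "compact {x :: nat \<Rightarrow> real. \<forall>i. if i < p then x i \<in> {-1..1} else x i = 0}"
proof -
  let ?B = "\<lambda>i. if i < p then {-1..1} else {0 :: real}"
  have "compactin (product_topology (\<lambda>i. euclidean) UNIV) (PiE UNIV ?B)"
    unfolding compactin_PiE by auto
  hence "compact (PiE UNIV ?B)" by (simp add: euclidean_product_topology)
  moreover have "PiE UNIV ?B = {x. \<forall>i. if i < p then x i \<in> {-1..1} else x i = 0}"
    by (auto simp: PiE_def Pi_def split: if_splits)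
  ultimately show ?thesis by simp
qed

text \<open>The form is continuous on the compact set of unit vectors of the box orthogonal to all
  \<open>u j\<close>, which is nonempty because \<open>k < p\<close>. Homogeneity extends the bound
  from this set to all orthogonal vectors.\<close>

lemma rayleigh_maximizer:
  assumes "k < p"
  obtains w where "ip p w w = 1" "\<forall>j<k. ip p (u j) w = 0"
    "\<forall>x. (\<forall>j<k. ip p (u j) x = 0) \<longrightarrow> ip p x (mv p A x) \<le> ip p w (mv p A w) * ip p x x"
proof -
  let ?B = "{x :: nat \<Rightarrow> real. \<forall>i. if i < p then x i \<in> {-1..1} else x i = 0}"
  define V where "V = {x. ip p x x = 1} \<inter> (\<Inter>j<k. {x. ip p (u j) x = 0})"
  have "closed V"
    unfolding V_def
    by (intro closed_Int closed_INT closed_Collect_eq continuous_intros ballI)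
  hence "compact (?B \<inter> V)" by (intro compact_Int_closed compact_coordinate_box)
  \<comment> \<open>Besides normalising, \<open>nrm\<close> truncates to the first \<open>p\<close>
    coordinates, so that its values lie in the box; neither \<open>ip p\<close> nor
    \<open>mv p\<close> sees the truncation.\<close>
  define nrm where "nrm x = (\<lambda>i. if i < p then x i / sqrt (ip p x x) else 0)" for x
  have nrm: "nrm x \<in> ?B \<inter> V" "ip p x (mv p A x) = ip p x x * ip p (nrm x) (mv p A (nrm x))"
    if x: "ip p x x \<noteq> 0" "\<And>j. j < k \<Longrightarrow> ip p (u j) x = 0" for x
  proof -
    define s where "s = sqrt (ip p x x)"
    have s: "s > 0" "ip p x x = s * s"
      using x(1) ip_self_nonneg[of p x] by (auto simp: s_def)
    have nx: "nrm x i = inverse s * x i" if "i < p" for i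
      using that by (simp add: nrm_def s_def field_simps)
    have e: "ip p (u j) (nrm x) = inverse s * ip p (u j) x" for j
      by (subst ip_scale_right[symmetric], rule ip_cong) (simp_all add: nx)
    have 1: "ip p (nrm x) (nrm x) = inverse s * (inverse s * ip p x x)"
      by (subst ip_scale_right[symmetric], subst ip_scale_left[symmetric], rule ip_cong) (simp_all add: nx)
    have 2: "mv p A (nrm x) = (\<lambda>i. inverse s * mv p A x i)"
      by (subst mv_scale[symmetric], rule mv_cong) (simp add: nx)
    have 3: "ip p (nrm x) (mv p A (nrm x)) = inverse s * (inverse s * ip p x (mv p A x))"
      unfolding 2 by (subst ip_scale_right[symmetric], subst ip_scale_left[symmetric], rule ip_cong) (simp_all add: nx)
    have n1: "ip p (nrm x) (nrm x) = 1" unfolding 1 s(2) using s(1) by (simp add: field_simps)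
    have "\<bar>nrm x i\<bar> \<le> 1" if "i < p" for i
    proof -
      have "nrm x i * nrm x i \<le> ip p (nrm x) (nrm x)"
        unfolding ip_def using that by (intro member_le_sum) auto
      thus ?thesis using n1 by (simp add: abs_le_square_iff[of _ 1, simplified] power2_eq_square)
    qed
    moreover have "nrm x i = 0" if "\<not> i < p" for i using that by (simp add: nrm_def)
    ultimately have "nrm x \<in> ?B" by (simp add: abs_le_iff minus_le_iff)
    thus "nrm x \<in> ?B \<inter> V" unfolding V_def using n1 e x(2) by auto
    show "ip p x (mv p A x) = ip p x x * ip p (nrm x) (mv p A (nrm x))"
      unfolding 3 s(2) using s(1) by (simp add: field_simps)
  qed
  obtain x0 where x0: "\<exists>i<p. x0 i \<noteq> 0" "\<And>j. j < k \<Longrightarrow> ip p (u j) x0 = 0"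
    using exists_orthogonal_vector[OF assms, of u] by blast
  hence "nrm x0 \<in> ?B \<inter> V" by (intro nrm(1)) (auto simp: ip_self_eq_0_iff)
  hence "?B \<inter> V \<noteq> {}" by blast
  moreover have "continuous_on (?B \<inter> V) (\<lambda>x. ip p x (mv p A x))"
    by (intro continuous_intros)
  ultimately have "\<exists>w\<in>?B \<inter> V. \<forall>y\<in>?B \<inter> V. ip p y (mv p A y) \<le> ip p w (mv p A w)"
    by (intro continuous_attains_sup \<open>compact (?B \<inter> V)\<close>)
  then obtain w where w: "w \<in> ?B \<inter> V"
    "\<And>y. y \<in> ?B \<inter> V \<Longrightarrow> ip p y (mv p A y) \<le> ip p w (mv p A w)"
    by (elim bexE, intro that) (assumption, drule bspec)
  show ?thesis
  proof (rule that)
    show "ip p w w = 1" "\<forall>j<k. ip p (u j) w = 0" using w(1) by (auto simp: V_def)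
    have "ip p x (mv p A x) \<le> ip p w (mv p A w) * ip p x x" if "\<And>j. j < k \<Longrightarrow> ip p (u j) x = 0" for x
    proof (cases "ip p x x = 0")
      case True
      hence "ip p x (mv p A x) = 0" unfolding ip_self_eq_0_iff by (simp add: ip_def)
      with True show ?thesis by simp
    next
      case False
      have "ip p (nrm x) (mv p A (nrm x)) \<le> ip p w (mv p A w)"
        by (intro w(2) nrm(1) False that)
      from mult_left_mono[OF this ip_self_nonneg[of p x]]
      show ?thesis using nrm(2)[OF False that] by (simp add: mult.commute)
    qed
    thus "\<forall>x. (\<forall>j<k. ip p (u j) x = 0) \<longrightarrow> ip p x (mv p A x) \<le> ip p w (mv p A w) * ip p x x"
      by blast
  qed
qed

text \<open>First-order optimality without derivatives: a nonzero linear term would dominate the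
  quadratic one for small \<open>t\<close> of the right sign.\<close>

lemma linear_coeff_zero_if_quadratic_nonpos:
  fixes a b :: real
  assumes "\<And>t. 2 * t * a + t\<^sup>2 * b \<le> 0"
  shows "a = 0"
proof (rule ccontr)
  assume "a \<noteq> 0"
  \<comment> \<open>This \<open>t\<close> has the sign of \<open>a\<close>, and the denominator
    keeps the quadratic term below the linear one whatever \<open>b\<close> is.\<close>
  define t where "t = a / (1 + \<bar>b\<bar>)"
  have "2 * t * a + t\<^sup>2 * b = a\<^sup>2 * (2 * (1 + \<bar>b\<bar>) + b) / (1 + \<bar>b\<bar>)\<^sup>2"
  proof -
    have "1 + \<bar>b\<bar> \<noteq> 0" by linarith
    thus ?thesis unfolding t_def by (simp add: divide_simps power2_eq_square) (simp add: algebra_simps)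
  qed
  also have "\<dots> > 0" using \<open>a \<noteq> 0\<close> by (intro divide_pos_pos mult_pos_pos) auto
  finally show False using assms[of t] by simp
qed

text \<open>Maximising the Rayleigh quotient over successive orthogonal complements yields the
  eigenvalues already in decreasing order.\<close>

lemma orthonormal_eigenvectors_upto:
  assumes sym: "\<And>i j. i < p \<Longrightarrow> j < p \<Longrightarrow> A i j = A j i" and "k \<le> p"
  shows "\<exists>u \<phi>. (\<forall>i<k. \<forall>j<k. ip p (u i) (u j) = (if i = j then 1 else 0)) \<and>
     (\<forall>i<k. \<forall>a<p. mv p A (u i) a = \<phi> i * u i a) \<and>
     (\<forall>i<k. \<forall>x. (\<forall>j<i. ip p (u j) x = 0) \<longrightarrow> ip p x (mv p A x) \<le> \<phi> i * ip p x x)"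
  using \<open>k \<le> p\<close>
proof (induction k)
  case 0
  show ?case by simp
next
  case (Suc k)
  from Suc.IH[OF Suc_leD[OF Suc.prems]] obtain u \<phi> where *: "\<forall>i<k. \<forall>j<k. ip p (u i) (u j) = (if i = j then 1 else 0)"
    "\<forall>i<k. \<forall>a<p. mv p A (u i) a = \<phi> i * u i a"
    "\<forall>i<k. \<forall>x. (\<forall>j<i. ip p (u j) x = 0) \<longrightarrow> ip p x (mv p A x) \<le> \<phi> i * ip p x x"
    by (elim exE conjE, intro that) assumption+
  have on: "ip p (u i) (u j) = (if i = j then 1 else 0)" if "i < k" "j < k" for i j
    using *(1) that by blast
  have ev: "mv p A (u i) a = \<phi> i * u i a" if "i < k" "a < p" for i a
    using *(2) that by blast
  have mx: "ip p x (mv p A x) \<le> \<phi> i * ip p x x" if "i < k" "\<forall>j<i. ip p (u j) x = 0" for i x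
    using *(3) that by blast
  from Suc.prems have "k < p" by simp
  then obtain w where w: "ip p w w = 1" "\<forall>j<k. ip p (u j) w = 0"
    "\<forall>x. (\<forall>j<k. ip p (u j) x = 0) \<longrightarrow> ip p x (mv p A x) \<le> ip p w (mv p A w) * ip p x x"
    by (rule rayleigh_maximizer[of k p u A])
  define \<psi> where "\<psi> = ip p w (mv p A w)"
  \<comment> \<open>The residual of the eigenvalue equation; the goal is
    \<open>ip p z z = 0\<close>. It is orthogonal to \<open>w\<close> by the choice of
    \<open>\<psi>\<close>, and to the earlier \<open>u j\<close> because they are eigenvectors of a
    symmetric form.\<close>
  define z where "z = (\<lambda>a. mv p A w a - \<psi> * w a)"
  have wz: "ip p w z = 0"
    by (simp add: z_def ip_linear \<psi>_def w(1))
  have uz: "ip p (u j) z = 0" if "j < k" for j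
  proof -
    have "ip p (u j) (mv p A w) = ip p (mv p A (u j)) w" by (rule ip_mv_sym[OF sym])
    also have "\<dots> = ip p (\<lambda>a. \<phi> j * u j a) w" using ev that by (intro ip_cong) auto
    also have "\<dots> = 0" using w(2) that by (simp add: ip_linear)
    finally show ?thesis using w(2) that by (simp add: z_def ip_linear)
  qed
  \<comment> \<open>Perturbing the maximiser in the admissible direction \<open>z\<close> gives a
    nonpositive quadratic in \<open>t\<close> with this number as linear coefficient. By symmetry it
    equals \<open>ip p (mv p A w) z\<close>, which is \<open>ip p z z\<close> as \<open>w\<close> is
    orthogonal to \<open>z\<close>.\<close>
  have "ip p w (mv p A z) = 0"
  proof (rule linear_coeff_zero_if_quadratic_nonpos)
    fix t :: real
    let ?y = "\<lambda>a. w a + t * z a"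
    have "ip p ?y (mv p A ?y) \<le> \<psi> * ip p ?y ?y"
      unfolding \<psi>_def by (rule w(3)[rule_format]) (use w(2) uz in \<open>simp add: ip_linear\<close>)
    moreover have "ip p ?y ?y = 1 + t\<^sup>2 * ip p z z"
      using wz w(1) by (simp add: ip_linear ip_commute[of p z w] power2_eq_square)
    moreover have "ip p z (mv p A w) = ip p w (mv p A z)"
      by (subst ip_mv_sym[OF sym]) (simp_all add: ip_commute)
    hence "ip p ?y (mv p A ?y) = \<psi> + 2 * t * ip p w (mv p A z) + t\<^sup>2 * ip p z (mv p A z)"
      by (simp add: mv_add mv_scale ip_linear \<psi>_def power2_eq_square algebra_simps)
    ultimately show "2 * t * ip p w (mv p A z) + t\<^sup>2 * (ip p z (mv p A z) - \<psi> * ip p z z) \<le> 0"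
      by (simp add: algebra_simps)
  qed
  hence "ip p (mv p A w) z = 0" by (subst ip_mv_sym[OF sym, symmetric]) simp_all
  hence "ip p z z = 0" using wz by (subst (1) z_def) (simp add: ip_linear)
  hence evw: "mv p A w a = \<psi> * w a" if "a < p" for a
    using that by (simp add: ip_self_eq_0_iff z_def)
  let ?u = "u(k := w)" and ?f = "\<phi>(k := \<psi>)"
  have "ip p (?u i) (?u j) = (if i = j then 1 else 0)" if "i < Suc k" "j < Suc k" for i j
  proof -
    have "ip p w (u j) = 0" if "j < k" for j using w(2) that by (simp add: ip_commute[of p w "u j"])
    thus ?thesis using that on w(1,2) by (auto simp: less_Suc_eq)
  qed
  moreover have "mv p A (?u i) a = ?f i * ?u i a" if "i < Suc k" "a < p" for i a
    using that ev evw by (auto simp: less_Suc_eq)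
  moreover have "ip p x (mv p A x) \<le> ?f i * ip p x x"
    if "i < Suc k" "\<forall>j<i. ip p (?u j) x = 0" for i x
  proof (cases "i = k")
    case True
    thus ?thesis using w(3)[THEN spec, of x] that(2) by (simp add: \<psi>_def)
  next
    case False
    thus ?thesis using mx[of i x] that by auto
  qed
  ultimately show ?case by (intro exI[of _ ?u] exI[of _ ?f]) blast
qed

section \<open>Orthonormal bases and the identification of \<open>eigvals_desc\<close>\<close>

definition orthonormal_upto :: "nat \<Rightarrow> nat \<Rightarrow> (nat \<Rightarrow> nat \<Rightarrow> real) \<Rightarrow> bool" where
  "orthonormal_upto p m u \<longleftrightarrow> (\<forall>i<m. \<forall>j<m. ip p (u i) (u j) = (if i = j then 1 else 0))"

lemma orthonormal_uptoD:
  "orthonormal_upto p m u \<Longrightarrow> i < m \<Longrightarrow> j < m \<Longrightarrow> ip p (u i) (u j) = (if i = j then 1 else 0)"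
  by (simp add: orthonormal_upto_def)

text \<open>For a square matrix a right inverse is also a left inverse, so orthonormal rows force
  orthonormal columns. This is the completeness behind \<open>orthonormal_expansion\<close> and
  \<open>parseval\<close>.\<close>

lemma orthonormal_columns:
  assumes "orthonormal_upto p p u" "a < p" "b < p"
  shows "(\<Sum>i<p. u i a * u i b) = (if a = b then 1 else 0)"
proof -
  define U where "U = mat p p (\<lambda>(i,j). u i j)"
  have U: "U \<in> carrier_mat p p" "transpose_mat U \<in> carrier_mat p p" by (simp_all add: U_def)
  have "U * transpose_mat U = 1\<^sub>m p"
    using assms(1) by (intro eq_matI)
      (auto simp: U_def scalar_prod_def orthonormal_upto_def ip_def lessThan_atLeast0)
  hence "transpose_mat U * U = 1\<^sub>m p"
    using mat_mult_left_right_inverse[OF U] by simp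
  hence "(transpose_mat U * U) $$ (a,b) = (if a = b then 1 else 0)"
    using assms by simp
  thus ?thesis using assms(2,3)
    by (simp add: U_def scalar_prod_def lessThan_atLeast0)
qed

lemma orthonormal_expansion:
  assumes "orthonormal_upto p p u" "a < p"
  shows "x a = (\<Sum>i<p. ip p (u i) x * u i a)"
proof -
  have "(\<Sum>i<p. ip p (u i) x * u i a) = (\<Sum>i<p. \<Sum>b<p. x b * (u i b * u i a))"
    by (simp add: ip_def sum_distrib_right sum_distrib_left ac_simps)
  also have "\<dots> = (\<Sum>b<p. x b * (\<Sum>i<p. u i b * u i a))"
    by (subst sum.swap) (simp add: sum_distrib_left)
  also have "\<dots> = (\<Sum>b<p. x b * (if b = a then 1 else 0))"
    by (intro sum.cong refl) (use assms orthonormal_columns in auto)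
  also have "\<dots> = x a" using assms(2) by (simp add: if_distrib cong: if_cong)
  finally show ?thesis by simp
qed

lemma parseval:
  assumes "orthonormal_upto p p u"
  shows "ip p x y = (\<Sum>i<p. ip p (u i) x * ip p (u i) y)"
proof -
  have "ip p x y = ip p (\<lambda>a. \<Sum>i<p. ip p (u i) x * u i a) y"
    by (intro ip_cong orthonormal_expansion[OF assms] refl)
  also have "\<dots> = (\<Sum>i<p. ip p (u i) x * ip p (u i) y)"
    by (simp add: ip_sum_left ip_scale_left)
  finally show ?thesis .
qed

text \<open>Discharges the definite description: the order of each root of the characteristic
  polynomial fixes the multiset of values, and sortedness then fixes the list.\<close>

lemma eigvals_desc_eqI:
  assumes "length es = dim_row A" "sorted_wrt (\<ge>) es" "char_poly A = (\<Prod>e\<leftarrow>es. [:- e, 1:])"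
  shows "eigvals_desc A = es"
  unfolding eigvals_desc_def
proof (rule the_equality)
  show "length es = dim_row A \<and> sorted_wrt (\<ge>) es \<and> char_poly A = (\<Prod>e\<leftarrow>es. [:- e, 1:])"
    using assms by simp
  fix fs :: "real list"
  assume fs: "length fs = dim_row A \<and> sorted_wrt (\<ge>) fs \<and> char_poly A = (\<Prod>e\<leftarrow>fs. [:- e, 1:])"
  have cnt: "order a (\<Prod>e\<leftarrow>xs. [:- e, 1:]) = count (mset xs) a" for xs and a :: real
  proof (induction xs)
    case (Cons x xs)
    have nz: "(\<Prod>e\<leftarrow>xs. [:- e, 1:]) \<noteq> 0" by (auto simp: prod_list_zero_iff)
    hence "[:- x, 1:] * (\<Prod>e\<leftarrow>xs. [:- e, 1:]) \<noteq> 0" by (simp del: mult_pCons_left)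
    hence "order a (\<Prod>e\<leftarrow>x # xs. [:- e, 1:]) = order a [:- x, 1:] + order a (\<Prod>e\<leftarrow>xs. [:- e, 1:])"
      by (simp add: order_mult del: mult_pCons_left)
    moreover have "order a [:- x, 1:] = (if x = a then 1 else 0)"
      using order_linear_power'[of a x 1] by (auto intro: order_0I)
    ultimately show ?case using Cons.IH by simp
  qed (auto intro: order_0I)
  have "mset fs = mset es"
    by (intro multiset_eqI) (metis cnt fs assms(3))
  \<comment> \<open>Reversal turns decreasing lists into ascending ones, for which uniqueness of the
    sorted list of a multiset applies.\<close>
  hence "mset (rev fs) = mset (rev es)" by simp
  moreover have "sorted (rev fs)" "sorted (rev es)" using fs assms(2) by (simp_all add: sorted_wrt_rev)
  ultimately have "rev fs = rev es" by (metis sorted_sort_id properties_for_sort)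
  thus "fs = es" by simp
qed

text \<open>The Rayleigh maxima are the eigenvalues with multiplicity because the eigenbasis makes
  \<open>A\<close> similar to a diagonal matrix with the same characteristic polynomial. The list
  and the basis come in the same order, which the variational bounds rely on.\<close>

theorem spectral_decomposition:
  assumes "sym_mat p A"
  obtains u where "length (eigvals_desc A) = p" "sorted_wrt (\<ge>) (eigvals_desc A)"
    "orthonormal_upto p p u"
    "\<forall>a<p. \<forall>b<p. A $$ (a,b) = (\<Sum>i<p. eigvals_desc A ! i * u i a * u i b)"
proof -
  have A: "A \<in> carrier_mat p p" and tA: "transpose_mat A = A"
    using assms by (auto simp: sym_mat_def)
  define F where "F = (\<lambda>i j. A $$ (i,j))"
  have sym: "F i j = F j i" if "i < p" "j < p" for i j
  proof -
    have "transpose_mat A $$ (i,j) = A $$ (j,i)" using A that by simp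
    thus ?thesis by (simp add: F_def tA)
  qed
  obtain u \<phi> where 1: "\<forall>i<p. \<forall>j<p. ip p (u i) (u j) = (if i = j then 1 else 0)"
    and 2: "\<forall>i<p. \<forall>a<p. mv p F (u i) a = \<phi> i * u i a"
    and 3: "\<forall>i<p. \<forall>x. (\<forall>j<i. ip p (u j) x = 0) \<longrightarrow> ip p x (mv p F x) \<le> \<phi> i * ip p x x"
  proof -
    have "\<exists>u \<phi>. (\<forall>i<p. \<forall>j<p. ip p (u i) (u j) = (if i = j then 1 else 0)) \<and>
     (\<forall>i<p. \<forall>a<p. mv p F (u i) a = \<phi> i * u i a) \<and>
     (\<forall>i<p. \<forall>x. (\<forall>j<i. ip p (u j) x = 0) \<longrightarrow> ip p x (mv p F x) \<le> \<phi> i * ip p x x)"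
      by (rule orthonormal_eigenvectors_upto) (use sym in auto)
    thus ?thesis by (elim exE conjE) (rule that)
  qed
  have on: "orthonormal_upto p p u" using 1 by (simp add: orthonormal_upto_def)
  have qf: "ip p (u j) (mv p F (u j)) = \<phi> j" if "j < p" for j
  proof -
    have "ip p (u j) (mv p F (u j)) = ip p (u j) (\<lambda>a. \<phi> j * u j a)"
      by (intro ip_cong refl) (use 2 that in auto)
    thus ?thesis using orthonormal_uptoD[OF on that that] by (simp add: ip_linear)
  qed
  \<comment> \<open>For \<open>i < j\<close> the vector \<open>u j\<close> is orthogonal to the
    first \<open>i\<close> eigenvectors, hence a competitor in the maximisation that produced
    \<open>\<phi> i\<close>.\<close>
  have dec: "\<phi> j \<le> \<phi> i" if "i < j" "j < p" for i j
    using 3[rule_format, of i "u j"] qf[OF that(2)] that orthonormal_uptoD[OF on, of j j]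
      orthonormal_uptoD[OF on, of _ j]
    by auto
  have entry: "A $$ (a,b) = (\<Sum>i<p. \<phi> i * u i a * u i b)" if ab: "a < p" "b < p" for a b
  proof -
    \<comment> \<open>\<open>F a\<close> is row \<open>a\<close>; its coefficient along
      \<open>u i\<close> is coordinate \<open>a\<close> of the eigenvalue equation.\<close>
    have "ip p (u i) (F a) = \<phi> i * u i a" if "i < p" for i
      using 2 ab(1) that by (simp add: mv_def ip_def mult.commute)
    thus ?thesis using orthonormal_expansion[OF on ab(2), of "F a"] by (simp add: F_def)
  qed
  define es where "es = map \<phi> [0..<p]"
  have nth: "es ! i = \<phi> i" if "i < p" for i using that by (simp add: es_def)
  have "char_poly A = (\<Prod>e\<leftarrow>es. [:- e, 1:])"
  proof -
    define U where "U = mat p p (\<lambda>(i,j). u i j)"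
    define D where "D = mat p p (\<lambda>(i,j). if i = j then \<phi> i else 0)"
    have [simp]: "U \<in> carrier_mat p p" "transpose_mat U \<in> carrier_mat p p" "D \<in> carrier_mat p p"
      by (simp_all add: U_def D_def)
    have UU: "U * transpose_mat U = 1\<^sub>m p"
      using on by (intro eq_matI)
        (auto simp: U_def scalar_prod_def orthonormal_upto_def ip_def lessThan_atLeast0)
    hence UU': "transpose_mat U * U = 1\<^sub>m p"
      using mat_mult_left_right_inverse[of U p "transpose_mat U"] by simp
    have DU: "D * U = mat p p (\<lambda>(i,j). \<phi> i * u i j)"
      by (intro eq_matI) (auto simp: U_def D_def scalar_prod_def if_distrib[of "\<lambda>x. x * _"] cong: if_cong)
    have "A = transpose_mat U * (D * U)"
      unfolding DU using A entry by (intro eq_matI)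
        (auto simp: U_def scalar_prod_def lessThan_atLeast0 ac_simps)
    hence "A = transpose_mat U * D * U" by (simp add: assoc_mult_mat[where ?n\<^sub>1 = p and ?n\<^sub>2 = p and ?n\<^sub>3 = p and ?n\<^sub>4 = p])
    hence "similar_mat_wit A D (transpose_mat U) U"
      using A UU UU' by (simp add: similar_mat_wit_def Let_def) (simp add: U_def D_def)
    hence "similar_mat A D" unfolding similar_mat_def by blast
    hence "char_poly A = char_poly D" by (rule char_poly_similar)
    also have "\<dots> = (\<Prod>e\<leftarrow>diag_mat D. [:- e, 1:])"
      by (rule char_poly_upper_triangular[where n = p]) (auto simp: D_def)
    also have "diag_mat D = es" by (simp add: diag_mat_def D_def es_def)
    finally show ?thesis .
  qed
  moreover have "sorted_wrt (\<ge>) es"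
    using dec by (auto simp: sorted_wrt_iff_nth_less es_def)
  moreover have "length es = dim_row A" using A by (simp add: es_def)
  ultimately have "eigvals_desc A = es" by (intro eigvals_desc_eqI)
  thus ?thesis using that[of u] on entry nth \<open>sorted_wrt (\<ge>) es\<close> by (simp add: es_def)
qed

section \<open>Variational inequalities\<close>

lemma quadratic_form_spectral:
  assumes "orthonormal_upto p p u"
    "\<And>a b. a < p \<Longrightarrow> b < p \<Longrightarrow> A a b = (\<Sum>i<p. \<phi> i * u i a * u i b)"
  shows "ip p x (mv p A y) = (\<Sum>i<p. \<phi> i * ip p (u i) x * ip p (u i) y)"
proof -
  have "ip p x (mv p A y) = (\<Sum>a<p. \<Sum>b<p. \<Sum>i<p. \<phi> i * (u i a * x a) * (u i b * y b))"
    unfolding ip_mv by (intro sum.cong refl) (simp add: assms(2) sum_distrib_left sum_distrib_right ac_simps)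
  also have "\<dots> = (\<Sum>a<p. \<Sum>i<p. \<Sum>b<p. \<phi> i * (u i a * x a) * (u i b * y b))"
    by (rule sum.cong[OF refl], rule sum.swap)
  also have "\<dots> = (\<Sum>i<p. \<Sum>a<p. \<Sum>b<p. \<phi> i * (u i a * x a) * (u i b * y b))"
    by (rule sum.swap)
  also have "\<dots> = (\<Sum>i<p. \<phi> i * ip p (u i) x * ip p (u i) y)"
    by (simp add: ip_def sum_product sum_distrib_left ac_simps)
  finally show ?thesis .
qed

text \<open>Each eigenvector gets a weight \<open>c i\<close>, the squared length of its projection
  onto the span of the \<open>v j\<close> with \<open>d \<le> j\<close>. The weights lie between 0
  and 1 and add up to \<open>p - d\<close>, and the trace is the weighted sum of the
  \<open>\<phi> i\<close>; it is smallest when all weight sits on the last \<open>p - d\<close>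
  values.\<close>

lemma tail_eigenvalue_sum_le_trace:
  assumes u: "orthonormal_upto p p u" and v: "orthonormal_upto p p v" and "d \<le> p"
    and dec: "\<And>i j. i \<le> j \<Longrightarrow> j < p \<Longrightarrow> \<phi> j \<le> \<phi> i"
    and A: "\<And>a b. a < p \<Longrightarrow> b < p \<Longrightarrow> A a b = (\<Sum>i<p. \<phi> i * u i a * u i b)"
  shows "(\<Sum>i\<in>{d..<p}. \<phi> i) \<le> (\<Sum>j\<in>{d..<p}. ip p (v j) (mv p A (v j)))"
proof (cases "d = p")
  case False
  with \<open>d \<le> p\<close> have "d < p" by simp
  let ?J = "{d..<p}"
  define c where "c i = (\<Sum>j\<in>?J. (ip p (u i) (v j))\<^sup>2)" for i
  have c0: "0 \<le> c i" for i by (simp add: c_def sum_nonneg)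
  have c1: "c i \<le> 1" if "i < p" for i
  proof -
    have "c i \<le> (\<Sum>j<p. (ip p (u i) (v j))\<^sup>2)"
      unfolding c_def by (intro sum_mono2) auto
    also have "\<dots> = ip p (u i) (u i)"
      by (subst parseval[OF v, of "u i" "u i"]) (simp add: power2_eq_square ip_commute[of p "u i"])
    finally show ?thesis using orthonormal_uptoD[OF u that that] by simp
  qed
  have "(\<Sum>i<p. c i) = (\<Sum>j\<in>?J. \<Sum>i<p. ip p (u i) (v j) * ip p (u i) (v j))"
    unfolding c_def power2_eq_square by (rule sum.swap)
  also have "\<dots> = (\<Sum>j\<in>?J. 1)"
    using v by (intro sum.cong refl) (simp add: parseval[OF u, symmetric] orthonormal_uptoD)
  finally have csum: "(\<Sum>i<p. c i) = real (card ?J)" by simp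
  have split: "(\<Sum>i<p. f i) = (\<Sum>i<d. f i) + (\<Sum>i\<in>?J. f i)" for f :: "nat \<Rightarrow> real"
    using \<open>d \<le> p\<close> by (metis lessThan_atLeast0 sum.atLeastLessThan_concat zero_le)
  have "(\<Sum>j\<in>?J. ip p (v j) (mv p A (v j))) = (\<Sum>j\<in>?J. \<Sum>i<p. \<phi> i * (ip p (u i) (v j))\<^sup>2)"
    by (simp add: quadratic_form_spectral[OF u A] power2_eq_square mult.assoc)
  also have "\<dots> = (\<Sum>i<p. \<phi> i * c i)"
    by (subst sum.swap) (simp add: c_def sum_distrib_left)
  also have "\<dots> = (\<Sum>i<d. \<phi> i * c i) + (\<Sum>i\<in>?J. \<phi> i * (c i - 1)) + (\<Sum>i\<in>?J. \<phi> i)"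
    by (simp add: split algebra_simps sum_subtractf)
  finally have *: "(\<Sum>j\<in>?J. ip p (v j) (mv p A (v j))) = \<dots>" .
  \<comment> \<open>The threshold \<open>\<phi> d\<close> replaces every \<open>\<phi> i\<close>:
    for \<open>i < d\<close> the factor \<open>c i\<close> is nonnegative, from \<open>d\<close> on
    the factor \<open>c i - 1\<close> is nonpositive, so both replacements lower the sum. What
    remains is \<open>\<phi> d\<close> times zero. For \<open>d = p\<close> both tails are
    empty.\<close>
  have "(\<Sum>i<d. \<phi> d * c i) \<le> (\<Sum>i<d. \<phi> i * c i)"
    using \<open>d < p\<close> by (intro sum_mono mult_right_mono dec c0) auto
  moreover have "(\<Sum>i\<in>?J. \<phi> d * (c i - 1)) \<le> (\<Sum>i\<in>?J. \<phi> i * (c i - 1))"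
    using c1 by (intro sum_mono mult_right_mono_neg dec) auto
  moreover have "(\<Sum>i<d. \<phi> d * c i) + (\<Sum>i\<in>?J. \<phi> d * (c i - 1)) = \<phi> d * ((\<Sum>i<p. c i) - card ?J)"
    by (simp add: split algebra_simps sum_subtractf sum_distrib_left)
  ultimately show ?thesis using * csum by simp
qed simp

text \<open>One half of min-max. The \<open>d\<close>-dimensional trial space contains a nonzero
  vector orthogonal to the top \<open>d - 1\<close> eigenvectors, and on it the form is at most
  \<open>\<phi> (d - 1)\<close> times the squared norm. The index is 0-based: this is the
  \<open>d\<close>-th largest value.\<close>

lemma eigenvalue_lower_bound:
  assumes u: "orthonormal_upto p p u" and v: "orthonormal_upto p p v" and "d \<le> p" "1 \<le> d"
    and dec: "\<And>i j. i \<le> j \<Longrightarrow> j < p \<Longrightarrow> \<phi> j \<le> \<phi> i"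
    and A: "\<And>a b. a < p \<Longrightarrow> b < p \<Longrightarrow> A a b = (\<Sum>i<p. \<phi> i * u i a * u i b)"
    and L: "\<And>a x. x = (\<lambda>c. \<Sum>j<d. a j * v j c) \<Longrightarrow> L * (\<Sum>j<d. (a j)\<^sup>2) \<le> ip p x (mv p A x)"
  shows "L \<le> \<phi> (d - 1)"
proof -
  from \<open>1 \<le> d\<close> have "d - 1 < d" by simp
  from exists_orthogonal_vector[OF this, of "\<lambda>i j. ip p (u i) (v j)"]
  obtain a where a: "(\<exists>j<d. a j \<noteq> 0) \<and> (\<forall>i<d-1. ip d (\<lambda>j. ip p (u i) (v j)) a = 0)"
    by (rule exE)
  define x where "x = (\<lambda>c. \<Sum>j<d. a j * v j c)"
  have ux: "ip p (u i) x = ip d (\<lambda>j. ip p (u i) (v j)) a" for i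
    by (simp add: x_def ip_sum_right ip_scale_right ip_def[of d] mult.commute)
  have "ip p x x = (\<Sum>j<d. \<Sum>k<d. a j * (a k * ip p (v j) (v k)))"
    unfolding x_def ip_sum_left ip_scale_left by (simp add: ip_sum_right ip_scale_right sum_distrib_left)
  also have "\<dots> = (\<Sum>j<d. \<Sum>k<d. if k = j then a j * a k else 0)"
    using v \<open>d \<le> p\<close> by (intro sum.cong refl) (auto simp: orthonormal_upto_def)
  also have "\<dots> = (\<Sum>j<d. (a j)\<^sup>2)" by (simp add: power2_eq_square)
  finally have xx: "ip p x x = (\<Sum>j<d. (a j)\<^sup>2)" .
  have pos: "0 < (\<Sum>j<d. (a j)\<^sup>2)"
  proof -
    obtain j where "j < d" "a j \<noteq> 0" using a by blast
    thus ?thesis by (intro sum_pos2[of _ j]) auto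
  qed
  have "ip p x (mv p A x) = (\<Sum>i<p. \<phi> i * (ip p (u i) x * ip p (u i) x))"
    by (simp add: quadratic_form_spectral[OF u A] mult.assoc)
  also have "\<dots> \<le> (\<Sum>i<p. \<phi> (d - 1) * (ip p (u i) x * ip p (u i) x))"
  proof (rule sum_mono)
    fix i assume "i \<in> {..<p}"
    show "\<phi> i * (ip p (u i) x * ip p (u i) x) \<le> \<phi> (d - 1) * (ip p (u i) x * ip p (u i) x)"
    proof (cases "i < d - 1")
      case True
      thus ?thesis using a ux by simp
    next
      case False
      thus ?thesis using \<open>i \<in> {..<p}\<close> by (intro mult_right_mono dec) auto
    qed
  qed
  also have "\<dots> = \<phi> (d - 1) * ip p x x"
    by (subst parseval[OF u]) (simp add: sum_distrib_left)
  finally have "L * (\<Sum>j<d. (a j)\<^sup>2) \<le> \<phi> (d - 1) * (\<Sum>j<d. (a j)\<^sup>2)"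
    using L[OF x_def] xx by simp
  thus ?thesis using pos by simp
qed

section \<open>Measurability of eigenvalues\<close>

text \<open>The largest remaining value is recovered from the power sums as a limit of \<open>l\<^sup>m\<close> norms.\<close>

lemma power_sum_root_limit:
  fixes \<phi> :: "nat \<Rightarrow> real"
  assumes nonneg: "\<And>i. i < p \<Longrightarrow> 0 \<le> \<phi> i" and dec: "\<And>i j. i \<le> j \<Longrightarrow> j < p \<Longrightarrow> \<phi> j \<le> \<phi> i"
    and "k < p"
  shows "(\<lambda>m. root (Suc m) ((\<Sum>i<p. \<phi> i ^ Suc m) - (\<Sum>i<k. \<phi> i ^ Suc m))) \<longlonglongrightarrow> \<phi> k"
proof (rule real_tendsto_sandwich)
  \<comment> \<open>The exponent is \<open>Suc m\<close> throughout because \<open>root 0\<close> is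
    constantly 0.\<close>
  have eq: "(\<Sum>i<p. \<phi> i ^ Suc m) - (\<Sum>i<k. \<phi> i ^ Suc m) = (\<Sum>i\<in>{k..<p}. \<phi> i ^ Suc m)" for m
    using \<open>k < p\<close> by (simp add: lessThan_atLeast0 sum.atLeastLessThan_concat[of 0 k p, symmetric] del: power_Suc)
  have 0: "0 \<le> \<phi> k" using nonneg \<open>k < p\<close> by simp
  have "\<phi> k \<le> root (Suc m) (\<Sum>i\<in>{k..<p}. \<phi> i ^ Suc m)" for m
  proof -
    have "\<phi> k ^ Suc m \<le> (\<Sum>i\<in>{k..<p}. \<phi> i ^ Suc m)"
      using \<open>k < p\<close> by (intro member_le_sum) (auto intro!: zero_le_power nonneg simp del: power_Suc)
    hence "root (Suc m) (\<phi> k ^ Suc m) \<le> root (Suc m) (\<Sum>i\<in>{k..<p}. \<phi> i ^ Suc m)" by simp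
    thus ?thesis using real_root_power_cancel[OF zero_less_Suc 0, of m] by (simp del: power_Suc)
  qed
  thus "\<forall>\<^sub>F m in sequentially. \<phi> k \<le> root (Suc m) ((\<Sum>i<p. \<phi> i ^ Suc m) - (\<Sum>i<k. \<phi> i ^ Suc m))"
    unfolding eq by simp
  \<comment> \<open>The remaining sum has at most \<open>p\<close> terms, none above
    \<open>\<phi> k ^ Suc m\<close>; the root of the number of terms tends to 1.\<close>
  have "root (Suc m) (\<Sum>i\<in>{k..<p}. \<phi> i ^ Suc m) \<le> root (Suc m) (real p) * \<phi> k" for m
  proof -
    have "(\<Sum>i\<in>{k..<p}. \<phi> i ^ Suc m) \<le> (\<Sum>i\<in>{k..<p}. \<phi> k ^ Suc m)"
      by (intro sum_mono power_mono dec nonneg) auto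
    also have "\<dots> \<le> real p * \<phi> k ^ Suc m"
      using 0 by (auto intro!: mult_right_mono simp del: power_Suc)
    finally have "root (Suc m) (\<Sum>i\<in>{k..<p}. \<phi> i ^ Suc m) \<le> root (Suc m) (real p * \<phi> k ^ Suc m)" by simp
    thus ?thesis using real_root_power_cancel[OF zero_less_Suc 0, of m] by (simp add: real_root_mult del: power_Suc)
  qed
  thus "\<forall>\<^sub>F m in sequentially. root (Suc m) ((\<Sum>i<p. \<phi> i ^ Suc m) - (\<Sum>i<k. \<phi> i ^ Suc m))
      \<le> root (Suc m) (real p) * \<phi> k"
    unfolding eq by simp
  have "(\<lambda>m. root (Suc m) (real p)) \<longlonglongrightarrow> 1"
    using LIMSEQ_root_const[of "real p"] \<open>k < p\<close> by (intro LIMSEQ_Suc) simp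
  from tendsto_mult[OF this tendsto_const, of "\<phi> k"]
  show "(\<lambda>m. root (Suc m) (real p) * \<phi> k) \<longlonglongrightarrow> \<phi> k" by simp
qed simp

text \<open>Strong induction on \<open>k\<close>: once the larger values are measurable, their
  powers can be subtracted from the power sums, and \<open>power_sum_root_limit\<close> exhibits
  \<open>\<phi> x k\<close> as a pointwise limit of measurable functions.\<close>

lemma measurable_from_power_sums:
  fixes \<phi> :: "'x \<Rightarrow> nat \<Rightarrow> real"
  assumes nonneg: "\<And>x i. x \<in> space M \<Longrightarrow> i < p \<Longrightarrow> 0 \<le> \<phi> x i"
    and dec: "\<And>x i j. x \<in> space M \<Longrightarrow> i \<le> j \<Longrightarrow> j < p \<Longrightarrow> \<phi> x j \<le> \<phi> x i"
    and meas: "\<And>m. (\<lambda>x. \<Sum>i<p. \<phi> x i ^ m) \<in> borel_measurable M" and "k < p"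
  shows "(\<lambda>x. \<phi> x k) \<in> borel_measurable M"
  using \<open>k < p\<close>
proof (induction k rule: less_induct)
  case (less k)
  have [measurable]: "(\<lambda>x. \<phi> x i) \<in> borel_measurable M" if "i \<in> {..<k}" for i
    using less that by simp
  note meas[measurable]
  show ?case
  proof (rule borel_measurable_LIMSEQ_real)
    show "(\<lambda>m. root (Suc m) ((\<Sum>i<p. \<phi> x i ^ Suc m) - (\<Sum>i<k. \<phi> x i ^ Suc m))) \<longlonglongrightarrow> \<phi> x k"
      if "x \<in> space M" for x
      using nonneg[OF that] dec[OF that] less.prems by (rule power_sum_root_limit)
    show "(\<lambda>x. root (Suc m) ((\<Sum>i<p. \<phi> x i ^ Suc m) - (\<Sum>i<k. \<phi> x i ^ Suc m))) \<in> borel_measurable M" for m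
      by measurable
  qed
qed

section \<open>Traces of matrix powers\<close>

fun mpow :: "nat \<Rightarrow> (nat \<Rightarrow> nat \<Rightarrow> real) \<Rightarrow> nat \<Rightarrow> nat \<Rightarrow> nat \<Rightarrow> real" where
  "mpow p A 0 a b = (if a = b then 1 else 0)"
| "mpow p A (Suc m) a b = (\<Sum>c<p. A a c * mpow p A m c b)"

lemma mpow_spectral:
  assumes u: "orthonormal_upto p p u"
    and A: "\<And>a b. a < p \<Longrightarrow> b < p \<Longrightarrow> A a b = (\<Sum>i<p. \<phi> i * u i a * u i b)"
    and "a < p" "b < p"
  shows "mpow p A m a b = (\<Sum>i<p. \<phi> i ^ m * u i a * u i b)"
  using \<open>a < p\<close>
proof (induction m arbitrary: a)
  case 0
  thus ?case using orthonormal_columns[OF u 0 \<open>b < p\<close>] by simp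
next
  case (Suc m)
  have "mpow p A (Suc m) a b = (\<Sum>c<p. A a c * (\<Sum>i<p. \<phi> i ^ m * u i c * u i b))"
    using Suc.IH by simp
  also have "\<dots> = (\<Sum>i<p. \<phi> i ^ m * u i b * (\<Sum>c<p. A a c * u i c))"
    by (simp add: sum_distrib_left ac_simps) (rule sum.swap)
  also have "\<dots> = (\<Sum>i<p. \<phi> i ^ Suc m * u i a * u i b)"
  proof (intro sum.cong refl)
    fix i assume "i \<in> {..<p}"
    have "(\<Sum>c<p. A a c * u i c) = (\<Sum>c<p. \<Sum>j<p. \<phi> j * u j a * (u j c * u i c))"
      by (intro sum.cong refl) (simp add: A[OF Suc.prems] sum_distrib_right mult.assoc)
    also have "\<dots> = (\<Sum>j<p. \<phi> j * u j a * ip p (u j) (u i))"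
      by (subst sum.swap) (simp add: ip_def sum_distrib_left)
    also have "\<dots> = (\<Sum>j<p. if j = i then \<phi> j * u j a else 0)"
      using u \<open>i \<in> {..<p}\<close> by (intro sum.cong refl) (auto simp: orthonormal_upto_def)
    also have "\<dots> = \<phi> i * u i a" using \<open>i \<in> {..<p}\<close> by simp
    finally show "\<phi> i ^ m * u i b * (\<Sum>c<p. A a c * u i c) = \<phi> i ^ Suc m * u i a * u i b" by simp
  qed
  finally show ?case .
qed

lemma trace_mpow:
  assumes u: "orthonormal_upto p p u"
    and A: "\<And>a b. a < p \<Longrightarrow> b < p \<Longrightarrow> A a b = (\<Sum>i<p. \<phi> i * u i a * u i b)"
  shows "(\<Sum>a<p. mpow p A m a a) = (\<Sum>i<p. \<phi> i ^ m)"
proof -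
  have "(\<Sum>a<p. mpow p A m a a) = (\<Sum>a<p. \<Sum>i<p. \<phi> i ^ m * u i a * u i a)"
    by (intro sum.cong refl mpow_spectral[OF u A]) auto
  also have "\<dots> = (\<Sum>i<p. \<phi> i ^ m * ip p (u i) (u i))"
    by (subst sum.swap) (simp add: ip_def sum_distrib_left mult.assoc)
  also have "\<dots> = (\<Sum>i<p. \<phi> i ^ m)"
    using u by (intro sum.cong refl) (simp add: orthonormal_uptoD)
  finally show ?thesis .
qed

lemma eigvals_desc_decreasing:
  assumes "sym_mat p A" "i \<le> j" "j < p"
  shows "eigvals_desc A ! j \<le> eigvals_desc A ! i"
proof -
  obtain u where "length (eigvals_desc A) = p" "sorted_wrt (\<ge>) (eigvals_desc A)"
    by (rule spectral_decomposition[OF assms(1)])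
  thus ?thesis using assms(2,3) sorted_wrt_nth_less[of "(\<ge>)" "eigvals_desc A" i j]
    by (cases "i = j") auto
qed

lemma quadratic_form_eigenvector:
  assumes u: "orthonormal_upto p p u"
    and A: "\<And>a b. a < p \<Longrightarrow> b < p \<Longrightarrow> A a b = (\<Sum>i<p. \<phi> i * u i a * u i b)"
    and "j < p" "k < p"
  shows "ip p (u j) (mv p A (u k)) = (if j = k then \<phi> j else 0)"
proof -
  have "ip p (u j) (mv p A (u k)) = (\<Sum>i<p. if i = j then (if j = k then \<phi> j else 0) else 0)"
    unfolding quadratic_form_spectral[OF u A, simplified]
    by (intro sum.cong refl) (use u assms(3,4) in \<open>auto simp: orthonormal_upto_def\<close>)
  thus ?thesis using \<open>j < p\<close> by simp
qed

lemma eigvals_desc_nonneg: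
  assumes "sym_mat p A" and psd: "\<And>x. 0 \<le> ip p x (mv p (\<lambda>a b. A $$ (a,b)) x)" and "i < p"
  shows "0 \<le> eigvals_desc A ! i"
proof -
  obtain u where u: "length (eigvals_desc A) = p" "sorted_wrt (\<ge>) (eigvals_desc A)" "orthonormal_upto p p u"
    "\<forall>a<p. \<forall>b<p. A $$ (a,b) = (\<Sum>i<p. eigvals_desc A ! i * u i a * u i b)"
    by (rule spectral_decomposition[OF assms(1)])
  from quadratic_form_eigenvector[OF u(3) u(4)[rule_format] \<open>i < p\<close> \<open>i < p\<close>] psd[of "u i"] show ?thesis by simp
qed

text \<open>Traces of powers are polynomials in the entries, hence measurable, and equal the power
  sums of the eigenvalues. Semidefiniteness supplies the signs that the root limit needs.\<close>

lemma measurable_eigvals_desc: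
  assumes sym: "\<And>x. x \<in> space M \<Longrightarrow> sym_mat p (S x)"
    and psd: "\<And>x v. x \<in> space M \<Longrightarrow> 0 \<le> ip p v (mv p (\<lambda>a b. S x $$ (a,b)) v)"
    and meas: "\<And>a b. a < p \<Longrightarrow> b < p \<Longrightarrow> (\<lambda>x. S x $$ (a,b)) \<in> borel_measurable M" and "k < p"
  shows "(\<lambda>x. eigvals_desc (S x) ! k) \<in> borel_measurable M"
proof (rule measurable_from_power_sums[where \<phi> = "\<lambda>x i. eigvals_desc (S x) ! i"])
  show "0 \<le> eigvals_desc (S x) ! i" if "x \<in> space M" "i < p" for x i
    using eigvals_desc_nonneg sym psd that by blast
  show "eigvals_desc (S x) ! j \<le> eigvals_desc (S x) ! i" if "x \<in> space M" "i \<le> j" "j < p" for x i j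
    using eigvals_desc_decreasing sym that by blast
  fix m
  have pw: "(\<lambda>x. mpow p (\<lambda>a b. S x $$ (a,b)) m a b) \<in> borel_measurable M" if "a < p" "b < p" for a b
    using that
  proof (induction m arbitrary: a)
    case (Suc m)
    show ?case unfolding mpow.simps
      by (intro borel_measurable_sum borel_measurable_times meas Suc.IH) (use Suc.prems in auto)
  qed simp
  have "(\<lambda>x. \<Sum>a<p. mpow p (\<lambda>a b. S x $$ (a,b)) m a a) \<in> borel_measurable M"
    by (intro borel_measurable_sum pw) auto
  also have "?this \<longleftrightarrow> (\<lambda>x. \<Sum>i<p. (eigvals_desc (S x) ! i) ^ m) \<in> borel_measurable M"
  proof (rule measurable_cong)
    fix x assume "x \<in> space M"
    obtain u where u: "length (eigvals_desc (S x)) = p" "sorted_wrt (\<ge>) (eigvals_desc (S x))"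
      "orthonormal_upto p p u"
      "\<forall>a<p. \<forall>b<p. S x $$ (a,b) = (\<Sum>i<p. eigvals_desc (S x) ! i * u i a * u i b)"
      by (rule spectral_decomposition[OF sym[OF \<open>x \<in> space M\<close>]])
    show "(\<Sum>a<p. mpow p (\<lambda>a b. S x $$ (a,b)) m a a) = (\<Sum>i<p. (eigvals_desc (S x) ! i) ^ m)"
      using u(3) u(4)[rule_format] by (rule trace_mpow)
  qed
  finally show "(\<lambda>x. \<Sum>i<p. (eigvals_desc (S x) ! i) ^ m) \<in> borel_measurable M" .
qed (rule \<open>k < p\<close>)

section \<open>Linear forms of the multivariate normal distribution\<close>

text \<open>Entries of \<open>R\<close> above the diagonal are ignored.\<close>

definition ltv :: "(nat \<Rightarrow> nat \<Rightarrow> real) \<Rightarrow> (nat \<Rightarrow> real) \<Rightarrow> nat \<Rightarrow> real" where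
  "ltv R x i = (\<Sum>j\<le>i. R i j * x j)"

text \<open>Completing the square in the last coordinate splits off one square and leaves the Schur
  complement \<open>S\<close> on the others, so \<open>Q\<close> becomes \<open>R\<close> transposed
  times \<open>R\<close> with \<open>R\<close> lower triangular. The identity is stated for two
  vectors because \<open>distributed_linear_form\<close> pairs different ones.\<close>

lemma cholesky_form:
  assumes "\<And>i j. i < p \<Longrightarrow> j < p \<Longrightarrow> Q i j = Q j i"
    and "\<And>x. \<exists>i<p. x i \<noteq> 0 \<Longrightarrow> 0 < ip p x (mv p Q x)"
  shows "\<exists>R. (\<forall>i<p. 0 < R i i) \<and> (\<forall>x y. ip p x (mv p Q y) = ip p (ltv R x) (ltv R y))"
  using assms
proof (induction p arbitrary: Q)
  case 0
  show ?case by (simp add: ip_def)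
next
  case (Suc p)
  define q where "q = Q p p"
  define S where "S i j = Q i j - Q p i * Q p j / q" for i j
  define t where "t x = (\<Sum>j<p. Q p j * x j)" for x
  have "0 < ip (Suc p) (\<lambda>i. if i = p then 1 else 0) (mv (Suc p) Q (\<lambda>i. if i = p then 1 else 0))"
    by (rule Suc.prems(2), rule exI[of _ p]) simp
  hence q: "q > 0" by (simp add: ip_def mv_def q_def)
  have form: "ip (Suc p) x (mv (Suc p) Q y) = ip p x (mv p S y) + (q * x p + t x) * (q * y p + t y) / q"
    for x y
  proof -
    have "ip (Suc p) x (mv (Suc p) Q y)
        = (\<Sum>i<p. \<Sum>j<p. x i * Q i j * y j) + y p * (\<Sum>i<p. Q i p * x i) + x p * t y + q * x p * y p"
      by (simp add: ip_mv sum.distrib t_def q_def sum_distrib_left ac_simps)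
    also have "(\<Sum>i<p. Q i p * x i) = t x"
      unfolding t_def by (intro sum.cong refl) (use Suc.prems(1) in auto)
    finally have 1: "ip (Suc p) x (mv (Suc p) Q y)
        = (\<Sum>i<p. \<Sum>j<p. x i * Q i j * y j) + y p * t x + x p * t y + q * x p * y p" .
    have "ip p x (mv p S y) = (\<Sum>i<p. \<Sum>j<p. x i * Q i j * y j - (Q p i * x i) * (Q p j * y j) / q)"
      unfolding ip_mv S_def by (intro sum.cong refl) (simp add: algebra_simps)
    also have "\<dots> = (\<Sum>i<p. \<Sum>j<p. x i * Q i j * y j) - t x * t y / q"
      by (simp add: sum_subtractf t_def sum_product sum_divide_distrib)
    finally show ?thesis using 1 q by (simp add: field_simps)
  qed
  have "\<exists>R. (\<forall>i<p. 0 < R i i) \<and> (\<forall>x y. ip p x (mv p S y) = ip p (ltv R x) (ltv R y))"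
  proof (rule Suc.IH)
    show "S i j = S j i" if "i < p" "j < p" for i j
      using Suc.prems(1)[of i j] that by (simp add: S_def)
    fix x :: "nat \<Rightarrow> real" assume x: "\<exists>i<p. x i \<noteq> 0"
    \<comment> \<open>The last coordinate is chosen to annihilate the completed square, so
      positivity of \<open>Q\<close> at \<open>x'\<close> is positivity of \<open>S\<close> at
      \<open>x\<close>.\<close>
    define x' where "x' = x(p := - t x / q)"
    have tx: "t x' = t x" by (simp add: t_def x'_def)
    have "ip p x' (mv p S x') = ip p x (mv p S x)"
      by (simp add: ip_mv x'_def)
    moreover have "0 < ip (Suc p) x' (mv (Suc p) Q x')"
      by (rule Suc.prems(2)) (use x in \<open>auto simp: x'_def intro: less_SucI\<close>)
    moreover have "q * x' p + t x' = 0" unfolding tx using q by (simp add: x'_def)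
    ultimately show "0 < ip p x (mv p S x)" by (simp add: form)
  qed
  then obtain R where R: "(\<forall>i<p. 0 < R i i) \<and> (\<forall>x y. ip p x (mv p S y) = ip p (ltv R x) (ltv R y))"
    by (rule exE)
  \<comment> \<open>The new last row is the completed square divided by \<open>sqrt q\<close>; the
    earlier rows are untouched.\<close>
  define R' where "R' = R(p := \<lambda>j. if j = p then sqrt q else Q p j / sqrt q)"
  have lo: "ltv R' x i = ltv R x i" if "i < p" for x i
    using that by (simp add: ltv_def R'_def)
  have hi: "ltv R' x p = (q * x p + t x) / sqrt q" for x
  proof -
    have "ltv R' x p = sqrt q * x p + t x / sqrt q"
      by (simp add: ltv_def R'_def t_def lessThan_Suc_atMost[symmetric] sum_divide_distrib)
    thus ?thesis using q by (simp add: field_simps)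
  qed
  have "ip (Suc p) x (mv (Suc p) Q y) = ip (Suc p) (ltv R' x) (ltv R' y)" for x y
  proof -
    have "ip (Suc p) (ltv R' x) (ltv R' y) = ip p (ltv R x) (ltv R y) + ltv R' x p * ltv R' y p"
      by (simp add: ip_def lo)
    also have "ltv R' x p * ltv R' y p = (q * x p + t x) * (q * y p + t y) / q"
      using q by (simp add: hi)
    finally show ?thesis using form R by simp
  qed
  moreover have "\<forall>i<Suc p. 0 < R' i i" using R q by (auto simp: R'_def less_Suc_eq)
  ultimately show ?case by blast
qed

text \<open>The factor is triangular so that the change of variables below reduces, by Fubini, to
  one-dimensional affine substitutions.\<close>

definition whiten :: "nat \<Rightarrow> (nat \<Rightarrow> nat \<Rightarrow> real) \<Rightarrow> (nat \<Rightarrow> real) \<Rightarrow> (nat \<Rightarrow> real) \<Rightarrow> nat \<Rightarrow> real" where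
  "whiten p R m x = (\<lambda>i\<in>{0..<p}. ltv R (\<lambda>j. x j - m j) i)"

lemma measurable_whiten [measurable]:
  "whiten p R m \<in> measurable (PiM {0..<p} (\<lambda>_. lborel)) (PiM {0..<p} (\<lambda>_. lborel))"
  unfolding whiten_def
proof (rule measurable_restrict)
  fix i assume "i \<in> {0..<p}"
  have "(\<lambda>x. x j) \<in> borel_measurable (PiM {0..<p} (\<lambda>_. lborel :: real measure))" if "j \<le> i" for j
    using measurable_component_singleton[of j "{0..<p}" "\<lambda>_. lborel :: real measure"]
      \<open>i \<in> {0..<p}\<close> that by simp
  thus "(\<lambda>x. ltv R (\<lambda>j. x j - m j) i) \<in> measurable (PiM {0..<p} (\<lambda>_. lborel)) lborel"
    unfolding ltv_def measurable_lborel1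
    by (intro borel_measurable_sum borel_measurable_times borel_measurable_diff) auto
qed

lemma ennreal_mult_divide_cancel:
  assumes "0 < a"
  shows "ennreal a * b / ennreal a = b" "ennreal a * (b / ennreal a) = b"
proof -
  show "ennreal a * b / ennreal a = b"
    using assms by (subst mult.commute) (simp add: ennreal_mult_divide_eq)
  thus "ennreal a * (b / ennreal a) = b" by (simp add: ennreal_times_divide)
qed

text \<open>The product of the diagonal entries is the Jacobian determinant of a triangular affine
  map. Integrating the last coordinate innermost, each induction step is a one-dimensional affine
  substitution.\<close>

lemma nn_integral_whiten:
  assumes "H \<in> borel_measurable (PiM {0..<p} (\<lambda>_. lborel))" and pos: "\<And>i. i < p \<Longrightarrow> 0 < R i i"
  shows "(\<Prod>i<p. ennreal (R i i)) * (\<integral>\<^sup>+x. H (whiten p R m x) \<partial>PiM {0..<p} (\<lambda>_. lborel))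
     = (\<integral>\<^sup>+x. H x \<partial>PiM {0..<p} (\<lambda>_. lborel))"
  using assms
proof (induction p arbitrary: H)
  case 0
  interpret product_sigma_finite "\<lambda>_::nat. lborel :: real measure" by standard
  show ?case by (simp add: nn_integral_empty whiten_def restrict_def del: nn_integral_const)
next
  case (Suc p)
  interpret product_sigma_finite "\<lambda>_::nat. lborel :: real measure" by standard
  let ?L = "\<lambda>n. PiM {0..<n} (\<lambda>_::nat. lborel :: real measure)"
  have ins: "{0..<Suc p} = insert p {0..<p}" by auto
  have H: "H \<in> borel_measurable (PiM (insert p {0..<p}) (\<lambda>_. lborel))"
    using Suc.prems(1) by (simp add: ins)
  note H[measurable]
  define G where "G z = (\<integral>\<^sup>+y. H (z(p := y)) \<partial>lborel)" for z
  have G: "G \<in> borel_measurable (?L p)"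
    unfolding G_def by measurable
  \<comment> \<open>By triangularity the earlier outputs do not depend on \<open>y\<close>, and the
    last one is affine in \<open>y\<close> with slope \<open>R p p\<close>.\<close>
  have upd: "whiten (Suc p) R m (x(p := y))
      = (whiten p R m x)(p := ((\<Sum>j<p. R p j * (x j - m j)) - R p p * m p) + R p p * y)" for x y
    by (rule ext) (auto simp: whiten_def restrict_def ltv_def lessThan_Suc_atMost[symmetric]
        algebra_simps less_Suc_eq)
  have "(\<Prod>i<Suc p. ennreal (R i i)) * (\<integral>\<^sup>+x. H (whiten (Suc p) R m x) \<partial>?L (Suc p))
     = (\<Prod>i<Suc p. ennreal (R i i)) * (\<integral>\<^sup>+x. \<integral>\<^sup>+y. H (whiten (Suc p) R m (x(p := y))) \<partial>lborel \<partial>?L p)"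
    unfolding ins
    by (subst product_nn_integral_insert)
       (use Suc.prems(1) measurable_whiten[of "Suc p"] in \<open>auto simp: ins intro: measurable_compose\<close>)
  also have "(\<integral>\<^sup>+x. \<integral>\<^sup>+y. H (whiten (Suc p) R m (x(p := y))) \<partial>lborel \<partial>?L p)
     = (\<integral>\<^sup>+x. G (whiten p R m x) / ennreal (R p p) \<partial>?L p)"
  proof (rule nn_integral_cong)
    fix x assume "x \<in> space (?L p)"
    hence w: "whiten p R m x \<in> space (?L p)" by (rule measurable_space[OF measurable_whiten])
    have pos: "0 < R p p" using Suc.prems(2) by simp
    have "(\<lambda>y. H ((whiten p R m x)(p := y))) \<in> borel_measurable lborel"
      using measurable_component_update[OF w] by (intro measurable_compose[OF _ H]) auto
    hence "G (whiten p R m x) = ennreal (R p p) * (\<integral>\<^sup>+y. H (whiten (Suc p) R m (x(p := y))) \<partial>lborel)"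
      unfolding G_def upd
      by (subst nn_integral_real_affine[where c = "R p p" and t = "(\<Sum>j<p. R p j * (x j - m j)) - R p p * m p"])
         (use pos in auto)
    thus "(\<integral>\<^sup>+y. H (whiten (Suc p) R m (x(p := y))) \<partial>lborel) = G (whiten p R m x) / ennreal (R p p)"
      using ennreal_mult_divide_cancel(1)[OF pos] by simp
  qed
  also have "\<dots> = (\<integral>\<^sup>+x. G (whiten p R m x) \<partial>?L p) / ennreal (R p p)"
    using G by (intro nn_integral_divide) (auto intro: measurable_compose)
  also have "(\<Prod>i<Suc p. ennreal (R i i)) * \<dots> = (\<Prod>i<p. ennreal (R i i)) * (\<integral>\<^sup>+x. G (whiten p R m x) \<partial>?L p)"
    using ennreal_mult_divide_cancel(2)[OF Suc.prems(2)[of p]]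
    by (simp add: prod.lessThan_Suc mult.assoc)
  also have "\<dots> = (\<integral>\<^sup>+x. G x \<partial>?L p)"
    using G Suc.prems(2) by (intro Suc.IH) auto
  also have "\<dots> = (\<integral>\<^sup>+x. H x \<partial>?L (Suc p))"
    unfolding ins G_def by (subst product_nn_integral_insert) (use H in auto)
  finally show ?case .
qed

section \<open>The inverse covariance and its Cholesky factor\<close>

locale gaussian_vector =
  fixes p :: nat and mu :: "nat \<Rightarrow> real" and Sig :: "real mat"
  assumes pd: "pos_def_mat p Sig"
begin

definition Sf :: "nat \<Rightarrow> nat \<Rightarrow> real" where "Sf i j = Sig $$ (i,j)"

lemma Sig_carrier: "Sig \<in> carrier_mat p p" and Sig_sym: "i < p \<Longrightarrow> j < p \<Longrightarrow> Sf i j = Sf j i"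
proof -
  show *: "Sig \<in> carrier_mat p p" using pd by (simp add: pos_def_mat_def sym_mat_def)
  assume "i < p" "j < p"
  with * have "transpose_mat Sig $$ (i,j) = Sig $$ (j,i)" by simp
  thus "Sf i j = Sf j i" using pd by (simp add: Sf_def pos_def_mat_def sym_mat_def)
qed

lemma Sf_pos: "\<exists>i<p. x i \<noteq> 0 \<Longrightarrow> 0 < ip p x (mv p Sf x)"
  using pd by (simp add: pos_def_mat_def ip_mv Sf_def)

definition Qm :: "real mat" where "Qm = the (mat_inverse Sig)"
definition Qf :: "nat \<Rightarrow> nat \<Rightarrow> real" where "Qf i j = Qm $$ (i,j)"

lemma Sig_vec: "v \<in> carrier_vec p \<Longrightarrow> i < p \<Longrightarrow> (Sig *\<^sub>v v) $ i = mv p Sf (\<lambda>j. v $ j) i"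
  using Sig_carrier by (auto simp: mv_def Sf_def scalar_prod_def lessThan_atLeast0)

text \<open>Definiteness excludes a kernel vector, so \<open>Sig\<close> is invertible and
  \<open>mat_inverse\<close> returns a value; the \<open>the\<close> in \<open>mvn_density\<close>
  therefore denotes the true inverse.\<close>

lemma Sig_Qm: "Sig * Qm = 1\<^sub>m p" "Qm * Sig = 1\<^sub>m p" "Qm \<in> carrier_mat p p"
proof -
  have "det Sig \<noteq> 0"
  proof
    assume "det Sig = 0"
    then obtain v where v: "v \<in> carrier_vec p" "v \<noteq> 0\<^sub>v p" "Sig *\<^sub>v v = 0\<^sub>v p"
      using det_0_iff_vec_prod_zero[OF Sig_carrier] by auto
    have "\<exists>i<p. v $ i \<noteq> 0"
      using v(1,2) by (metis carrier_vecD eq_vecI index_zero_vec(1) index_zero_vec(2))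
    hence "0 < ip p (\<lambda>i. v $ i) (mv p Sf (\<lambda>i. v $ i))" by (rule Sf_pos)
    moreover have "mv p Sf (\<lambda>i. v $ i) i = 0" if "i < p" for i
      using Sig_vec[OF v(1) that] v(3) that by simp
    ultimately show False by (simp add: ip_def)
  qed
  hence "Sig \<in> Units (ring_mat TYPE(real) p ())"
    by (intro det_non_zero_imp_unit Sig_carrier)
  hence "mat_inverse Sig \<noteq> None" using mat_inverse(1)[OF Sig_carrier, of "()"] by auto
  then obtain B where "mat_inverse Sig = Some B" by auto
  thus "Sig * Qm = 1\<^sub>m p" "Qm * Sig = 1\<^sub>m p" "Qm \<in> carrier_mat p p"
    using mat_inverse(2)[OF Sig_carrier] by (auto simp: Qm_def)
qed

lemma Qf_sym: "i < p \<Longrightarrow> j < p \<Longrightarrow> Qf i j = Qf j i"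
proof -
  assume ij: "i < p" "j < p"
  have tS: "transpose_mat Sig = Sig" using pd by (simp add: pos_def_mat_def sym_mat_def)
  have "transpose_mat Qm * Sig = transpose_mat (Sig * Qm)"
    using Sig_carrier Sig_Qm(3) tS by (simp add: transpose_mult[where n = p])
  hence 1: "transpose_mat Qm * Sig = 1\<^sub>m p" by (simp add: Sig_Qm(1))
  have "transpose_mat Qm = transpose_mat Qm * (Sig * Qm)"
    using Sig_Qm by simp
  also have "\<dots> = transpose_mat Qm * Sig * Qm"
    using Sig_carrier Sig_Qm(3) by (simp add: assoc_mult_mat[where ?n\<^sub>1 = p and ?n\<^sub>2 = p and ?n\<^sub>3 = p and ?n\<^sub>4 = p])
  also have "\<dots> = Qm" using 1 Sig_Qm(3) by simp
  finally have "transpose_mat Qm = Qm" .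
  moreover have "transpose_mat Qm $$ (i,j) = Qm $$ (j,i)" using ij Sig_Qm(3) by simp
  ultimately show "Qf i j = Qf j i" by (simp add: Qf_def)
qed

lemma mv_Sf_Qf: "i < p \<Longrightarrow> mv p Sf (mv p Qf x) i = x i"
  and mv_Qf_Sf: "i < p \<Longrightarrow> mv p Qf (mv p Sf x) i = x i"
proof -
  have gen: "mv p A (mv p B x) i = x i"
    if AB: "\<And>i j. i < p \<Longrightarrow> j < p \<Longrightarrow> (\<Sum>k<p. A i k * B k j) = (if i = j then 1 else 0)" and "i < p"
    for A B :: "nat \<Rightarrow> nat \<Rightarrow> real" and i
  proof -
    have "mv p A (mv p B x) i = (\<Sum>k<p. \<Sum>j<p. A i k * B k j * x j)"
      by (simp add: mv_def sum_distrib_left mult.assoc)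
    also have "\<dots> = (\<Sum>j<p. (\<Sum>k<p. A i k * B k j) * x j)"
      by (subst sum.swap) (simp add: sum_distrib_right)
    also have "\<dots> = (\<Sum>j<p. if j = i then x j else 0)"
      using \<open>i < p\<close> AB by (intro sum.cong refl) auto
    finally show ?thesis using \<open>i < p\<close> by simp
  qed
  have "(\<Sum>k<p. Sf i k * Qf k j) = (Sig * Qm) $$ (i,j)" if "i < p" "j < p" for i j
    using that Sig_carrier Sig_Qm(3) by (auto simp: scalar_prod_def Sf_def Qf_def lessThan_atLeast0)
  thus "i < p \<Longrightarrow> mv p Sf (mv p Qf x) i = x i" by (intro gen) (simp_all add: Sig_Qm)
  have "(\<Sum>k<p. Qf i k * Sf k j) = (Qm * Sig) $$ (i,j)" if "i < p" "j < p" for i j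
    using that Sig_carrier Sig_Qm(3) by (auto simp: scalar_prod_def Sf_def Qf_def lessThan_atLeast0)
  thus "i < p \<Longrightarrow> mv p Qf (mv p Sf x) i = x i" by (intro gen) (simp_all add: Sig_Qm)
qed

text \<open>Substituting \<open>mv p Qf x\<close> into the positive form of \<open>Sig\<close> gives
  the inverse form at \<open>x\<close>.\<close>

lemma Qf_pos:
  assumes "\<exists>i<p. x i \<noteq> 0"
  shows "0 < ip p x (mv p Qf x)"
proof -
  have "\<exists>i<p. mv p Qf x i \<noteq> 0"
  proof (rule ccontr)
    assume "\<not> (\<exists>i<p. mv p Qf x i \<noteq> 0)"
    hence "mv p Sf (mv p Qf x) i = 0" for i by (simp add: mv_def[of p Sf])
    with mv_Sf_Qf assms show False by metis
  qed
  from Sf_pos[OF this] have "0 < ip p (mv p Qf x) (mv p Sf (mv p Qf x))" .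
  also have "\<dots> = ip p (mv p Qf x) x" by (intro ip_cong mv_Sf_Qf refl)
  finally show ?thesis by (simp add: ip_commute)
qed

text \<open>This factors the inverse covariance rather than \<open>Sig\<close>, so that
  \<open>ltv chol\<close> turns the exponent of the density into a sum of squares.\<close>

definition chol :: "nat \<Rightarrow> nat \<Rightarrow> real" where
  "chol = (SOME R. (\<forall>i<p. 0 < R i i) \<and> (\<forall>x y. ip p x (mv p Qf y) = ip p (ltv R x) (ltv R y)))"

lemma chol_pos: "i < p \<Longrightarrow> 0 < chol i i"
  and chol_form: "ip p x (mv p Qf y) = ip p (ltv chol x) (ltv chol y)"
  using someI_ex[OF cholesky_form[of p Qf, OF Qf_sym Qf_pos, simplified]] 
  unfolding chol_def[symmetric] by simp_all

end

section \<open>Law of the whitened vector and of linear forms\<close>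

lemma prob_space_std_normal: "prob_space (density lborel std_normal_density)"
  by (rule prob_space_normal_density) simp

context gaussian_vector
begin

text \<open>Matches the normalising constant of the density with the Jacobian of
  \<open>whiten\<close>. Evaluating \<open>chol_form\<close> on unit vectors shows that
  \<open>Qm\<close> is a lower triangular matrix multiplied on the left by its transpose, so its
  determinant is the square of the diagonal product.\<close>

lemma det_Sig: "det Sig * (\<Prod>i<p. chol i i)\<^sup>2 = 1"
proof -
  define Rm where "Rm = mat p p (\<lambda>(i,j). if j \<le> i then chol i j else 0)"
  have Rm: "Rm \<in> carrier_mat p p" by (simp add: Rm_def)
  define e where "e a = (\<lambda>j::nat. if j = a then 1 else 0 :: real)" for a
  have le: "ltv chol (e a) i = (if a \<le> i then chol i a else 0)" for a i
    by (simp add: ltv_def e_def if_distrib cong: if_cong)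
  have entry: "Qf a b = (\<Sum>i<p. (if a \<le> i then chol i a else 0) * (if b \<le> i then chol i b else 0))"
    if "a < p" "b < p" for a b
  proof -
    have "ip p (e a) (mv p Qf (e b)) = Qf a b"
      using that by (simp add: ip_def mv_def e_def if_distrib[of "\<lambda>x. x * _"] if_distrib[of "\<lambda>x. _ * x"] cong: if_cong)
    thus ?thesis using chol_form[of "e a" "e b"] by (simp add: ip_def le)
  qed
  have "Qm = transpose_mat Rm * Rm"
    using Sig_Qm(3) entry
    by (intro eq_matI) (auto simp: Qf_def Rm_def scalar_prod_def lessThan_atLeast0 cong: if_cong)
  hence "det Qm = det Rm * det Rm"
    using Rm by (simp add: det_mult[where n = p] det_transpose[where n = p])
  moreover have "det Rm = prod_list (diag_mat Rm)"
    by (rule det_lower_triangular[OF _ Rm]) (simp add: Rm_def)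
  moreover have "diag_mat Rm = map (\<lambda>i. chol i i) [0..<p]"
    by (simp add: diag_mat_def Rm_def)
  moreover have "prod_list (map f [0..<m]) = (\<Prod>i<m. f i)" for f :: "nat \<Rightarrow> real" and m
    by (induction m) auto
  moreover have "det Sig * det Qm = 1"
    using det_mult[OF Sig_carrier Sig_Qm(3)] Sig_Qm(1) by simp
  ultimately show ?thesis by (simp add: power2_eq_square)
qed

lemma mvn_density_whiten:
  "mvn_density p mu Sig x = (\<Prod>i<p. chol i i) * (\<Prod>i\<in>{0..<p}. std_normal_density (whiten p chol mu x i))"
proof -
  define C where "C = (\<Prod>i<p. chol i i)"
  have C: "C > 0" unfolding C_def by (intro prod_pos) (auto simp: chol_pos)
  have dS: "det Sig = 1 / C\<^sup>2" using det_Sig C unfolding C_def[symmetric] by (simp add: field_simps)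
  define z where "z = ltv chol (\<lambda>j. x j - mu j)"
  have q: "(\<Sum>i<p. \<Sum>j<p. (x i - mu i) * Qm $$ (i,j) * (x j - mu j)) = (\<Sum>i<p. (z i)\<^sup>2)"
  proof -
    have "(\<Sum>i<p. \<Sum>j<p. (x i - mu i) * Qm $$ (i,j) * (x j - mu j))
        = ip p (\<lambda>i. x i - mu i) (mv p Qf (\<lambda>i. x i - mu i))"
      by (simp add: ip_mv Qf_def)
    thus ?thesis unfolding chol_form by (simp add: z_def ip_def power2_eq_square)
  qed
  have w: "whiten p chol mu x i = z i" if "i \<in> {0..<p}" for i
    using that by (simp add: whiten_def z_def)
  have "sqrt ((2 * pi) ^ p * det Sig) = sqrt (2 * pi) ^ p / C"
  proof -
    have "sqrt (det Sig) = 1 / C" using C by (simp add: dS real_sqrt_divide)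
    thus ?thesis by (subst real_sqrt_mult, subst real_sqrt_power) simp
  qed
  hence "mvn_density p mu Sig x = C * (exp (- (1/2) * (\<Sum>i<p. (z i)\<^sup>2)) / sqrt (2 * pi) ^ p)"
    unfolding mvn_density_def Let_def Qm_def[symmetric] q using C by simp
  also have "exp (- (1/2) * (\<Sum>i<p. (z i)\<^sup>2)) = (\<Prod>i<p. exp (- (z i)\<^sup>2 / 2))"
    by (simp add: exp_sum[symmetric] sum_negf sum_divide_distrib)
  also have "\<dots> / sqrt (2 * pi) ^ p = (\<Prod>i<p. std_normal_density (z i))"
    by (simp add: std_normal_density_def prod_dividef)
  also have "\<dots> = (\<Prod>i\<in>{0..<p}. std_normal_density (whiten p chol mu x i))"
    unfolding lessThan_atLeast0 by (intro prod.cong refl) (simp add: w)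
  finally show ?thesis by (simp add: C_def)
qed

abbreviation "L \<equiv> PiM {0..<p} (\<lambda>_::nat. lborel :: real measure)"

lemma measurable_mvn_density [measurable]: "mvn_density p mu Sig \<in> borel_measurable L"
proof -
  have "(\<lambda>x. std_normal_density (whiten p chol mu x i)) \<in> borel_measurable L" if "i \<in> {0..<p}" for i
  proof -
    have "(\<lambda>x. whiten p chol mu x i) \<in> measurable L lborel"
      using measurable_compose[OF measurable_whiten measurable_component_singleton[OF that]] .
    thus ?thesis by (rule measurable_compose) simp
  qed
  thus ?thesis unfolding mvn_density_whiten
    by (intro borel_measurable_times borel_measurable_const borel_measurable_prod) auto
qed

lemma space_mvn [simp]: "space (mvn p mu Sig) = space L"
  and sets_mvn [simp, measurable_cong]: "sets (mvn p mu Sig) = sets L"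
  by (simp_all add: mvn_def)

lemma measurable_whiten_mvn [measurable]: "whiten p chol mu \<in> measurable (mvn p mu Sig) L"
  by (simp add: measurable_cong_sets[OF sets_mvn refl])

text \<open>It is enough to compare the measures of boxes. There the density is the Jacobian times
  standard normal densities at the whitened point, so \<open>nn_integral_whiten\<close> leaves a
  product of one-dimensional integrals.\<close>

lemma distr_whiten:
  "distr (mvn p mu Sig) L (whiten p chol mu) = PiM {0..<p} (\<lambda>_. density lborel std_normal_density)"
proof -
  interpret P: product_sigma_finite "\<lambda>_::nat. density lborel (\<lambda>x. ennreal (std_normal_density x))"
    by (intro product_sigma_finite.intro prob_space_imp_sigma_finite prob_space_std_normal)
  interpret B: product_sigma_finite "\<lambda>_::nat. lborel :: real measure" by standard
  show ?thesis
  proof (rule P.PiM_eqI)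
    show "sets (distr (mvn p mu Sig) L (whiten p chol mu))
       = sets (PiM {0..<p} (\<lambda>_. density lborel std_normal_density))"
      by (simp only: sets_distr, rule sets_PiM_cong) auto
    fix A :: "nat \<Rightarrow> real set"
    assume "\<And>i. i \<in> {0..<p} \<Longrightarrow> A i \<in> sets (density lborel std_normal_density)"
    hence A: "A i \<in> sets borel" if "i \<in> {0..<p}" for i using that by simp
    define H where "H z = (\<Prod>i\<in>{0..<p}. ennreal (std_normal_density (z i)) * indicator (A i) (z i))"
      for z :: "nat \<Rightarrow> real"
    have Hm: "H \<in> borel_measurable L"
      unfolding H_def
    proof (intro borel_measurable_prod_ennreal)
      fix i assume i: "i \<in> {0..<p}"
      note A[OF i, measurable]
      have [measurable]: "(\<lambda>x. x i) \<in> measurable L borel"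
        using measurable_component_singleton[OF i, of "\<lambda>_. lborel :: real measure"] by simp
      show "(\<lambda>z. ennreal (std_normal_density (z i)) * indicator (A i) (z i)) \<in> borel_measurable L"
        by measurable
    qed
    have PA: "PiE {0..<p} A \<in> sets L" using A by (intro sets_PiM_I_finite) auto
    have "emeasure (distr (mvn p mu Sig) L (whiten p chol mu)) (PiE {0..<p} A)
       = emeasure (mvn p mu Sig) (whiten p chol mu -` PiE {0..<p} A \<inter> space L)"
      using PA by (simp add: emeasure_distr)
    also have "\<dots> = (\<integral>\<^sup>+x. ennreal (mvn_density p mu Sig x) *
        indicator (whiten p chol mu -` PiE {0..<p} A \<inter> space L) x \<partial>L)"
      unfolding mvn_def
      using measurable_sets[OF measurable_whiten[of p chol mu] PA] by (subst emeasure_density) auto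
    also have "\<dots> = (\<integral>\<^sup>+x. (\<Prod>i<p. ennreal (chol i i)) * H (whiten p chol mu x) \<partial>L)"
    proof (rule nn_integral_cong)
      fix x assume x: "x \<in> space L"
      have "ennreal (mvn_density p mu Sig x) = (\<Prod>i<p. ennreal (chol i i)) *
          (\<Prod>i\<in>{0..<p}. ennreal (std_normal_density (whiten p chol mu x i)))"
      proof -
        have "(\<Prod>i<p. ennreal (chol i i)) = ennreal (\<Prod>i<p. chol i i)"
          by (intro prod_ennreal) (auto simp: chol_pos less_imp_le)
        moreover have "0 \<le> (\<Prod>i<p. chol i i)" by (intro prod_nonneg) (auto simp: chol_pos less_imp_le)
        ultimately show ?thesis
          unfolding mvn_density_whiten by (simp add: ennreal_mult prod_nonneg prod_ennreal)
      qed
      moreover have "indicator (whiten p chol mu -` PiE {0..<p} A \<inter> space L) x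
          = (\<Prod>i\<in>{0..<p}. indicator (A i) (whiten p chol mu x i) :: ennreal)"
      proof (cases "\<forall>i\<in>{0..<p}. whiten p chol mu x i \<in> A i")
        case True
        thus ?thesis using x by (auto simp: whiten_def PiE_def indicator_def)
      next
        case False
        then obtain i where "i \<in> {0..<p}" "whiten p chol mu x i \<notin> A i" by auto
        thus ?thesis by (subst prod_zero) (auto simp: indicator_def PiE_def)
      qed
      ultimately show "ennreal (mvn_density p mu Sig x) *
          indicator (whiten p chol mu -` PiE {0..<p} A \<inter> space L) x
         = (\<Prod>i<p. ennreal (chol i i)) * H (whiten p chol mu x)"
        by (simp add: H_def prod.distrib mult.assoc)
    qed
    also have "\<dots> = (\<Prod>i<p. ennreal (chol i i)) * (\<integral>\<^sup>+x. H (whiten p chol mu x) \<partial>L)"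
      using Hm by (intro nn_integral_cmult) (auto intro: measurable_compose)
    also have "\<dots> = (\<integral>\<^sup>+z. H z \<partial>L)"
      using Hm by (intro nn_integral_whiten) (auto simp: chol_pos)
    also have "\<dots> = (\<Prod>i\<in>{0..<p}. \<integral>\<^sup>+y. ennreal (std_normal_density y) * indicator (A i) y \<partial>lborel)"
      unfolding H_def using A by (intro B.product_nn_integral_prod) auto
    also have "\<dots> = (\<Prod>i\<in>{0..<p}. emeasure (density lborel std_normal_density) (A i))"
      using A by (intro prod.cong refl) (simp add: emeasure_density)
    finally show "emeasure (distr (mvn p mu Sig) L (whiten p chol mu)) (PiE {0..<p} A)
       = (\<Prod>i\<in>{0..<p}. emeasure (density lborel std_normal_density) (A i))" .
  qed simp
qed

text \<open>The density is not integrated directly: a push-forward keeps total mass, and the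
  push-forward under \<open>whiten\<close> is a product of probability measures.\<close>

lemma prob_space_mvn: "prob_space (mvn p mu Sig)"
proof
  interpret G: prob_space "PiM {0..<p} (\<lambda>_. density lborel std_normal_density)"
    by (intro prob_space_PiM prob_space_std_normal)
  have "emeasure (mvn p mu Sig) (space L) = emeasure (distr (mvn p mu Sig) L (whiten p chol mu)) (space L)"
    by (subst emeasure_distr) (auto simp: measurable_space[OF measurable_whiten] intro!: arg_cong2[where f = emeasure])
  also have "\<dots> = 1"
  proof -
    have "space L = space (PiM {0..<p} (\<lambda>_. density lborel std_normal_density))"
      by (simp add: space_PiM)
    thus ?thesis unfolding distr_whiten by (simp add: G.emeasure_space_1)
  qed
  finally show "emeasure (mvn p mu Sig) (space (mvn p mu Sig)) = 1" by simp
qed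

lemma distributed_whiten:
  assumes "i < p"
  shows "distributed (mvn p mu Sig) lborel (\<lambda>x. whiten p chol mu x i) std_normal_density"
  unfolding distributed_def
proof (intro conjI)
  have i: "i \<in> {0..<p}" using assms by simp
  show m: "(\<lambda>x. whiten p chol mu x i) \<in> measurable (mvn p mu Sig) lborel"
    using measurable_compose[OF measurable_whiten_mvn measurable_component_singleton[OF i]] .
  have "distr (mvn p mu Sig) lborel (\<lambda>x. whiten p chol mu x i)
      = distr (distr (mvn p mu Sig) L (whiten p chol mu)) lborel (\<lambda>z. z i)"
    using measurable_component_singleton[OF i, of "\<lambda>_. lborel :: real measure"]
    by (subst distr_distr) (auto simp: comp_def)
  also have "\<dots> = distr (PiM {0..<p} (\<lambda>_. density lborel std_normal_density)) (density lborel std_normal_density) (\<lambda>z. z i)"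
    unfolding distr_whiten by (intro distr_cong) auto
  also have "\<dots> = density lborel std_normal_density"
    using i by (intro distr_PiM_component prob_space_std_normal)
  finally show "distr (mvn p mu Sig) lborel (\<lambda>x. whiten p chol mu x i) = density lborel std_normal_density" .
qed simp

lemma indep_whiten:
  assumes "p > 0"
  shows "prob_space.indep_vars (mvn p mu Sig) (\<lambda>_. borel) (\<lambda>i x. whiten p chol mu x i) {0..<p}"
proof -
  interpret prob_space "mvn p mu Sig" by (rule prob_space_mvn)
  have m: "(\<lambda>x. whiten p chol mu x i) \<in> measurable (mvn p mu Sig) borel" if "i \<in> {0..<p}" for i
    using distributed_measurable[OF distributed_whiten] that by simp
  have d: "distr (mvn p mu Sig) borel (\<lambda>x. whiten p chol mu x i) = density lborel std_normal_density"
    if "i \<in> {0..<p}" for i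
  proof -
    have "distr (mvn p mu Sig) borel (\<lambda>x. whiten p chol mu x i) = distr (mvn p mu Sig) lborel (\<lambda>x. whiten p chol mu x i)"
      by (intro distr_cong) auto
    thus ?thesis using distributed_whiten[of i] that by (simp add: distributed_def)
  qed
  have "distr (mvn p mu Sig) (PiM {0..<p} (\<lambda>_. borel)) (\<lambda>x. \<lambda>i\<in>{0..<p}. whiten p chol mu x i)
     = distr (mvn p mu Sig) L (whiten p chol mu)"
    by (intro distr_cong sets_PiM_cong) (auto simp: whiten_def restrict_def)
  also have "\<dots> = PiM {0..<p} (\<lambda>i. distr (mvn p mu Sig) borel (\<lambda>x. whiten p chol mu x i))"
    unfolding distr_whiten by (intro PiM_cong refl) (simp add: d)
  finally show ?thesis
    using assms m by (subst indep_vars_iff_distr_eq_PiM') auto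
qed

text \<open>With \<open>u = mv p Sf v\<close>, applying the inverse covariance to \<open>u\<close>
  returns \<open>v\<close>, so the form at \<open>v\<close> is the inner product of
  \<open>ltv chol u\<close> with the whitened sample. This is a combination of independent standard
  normals whose squared coefficients add up to the claimed variance.\<close>

lemma distributed_linear_form:
  assumes v: "\<exists>i<p. v i \<noteq> 0"
  shows "distributed (mvn p mu Sig) lborel (\<lambda>x. ip p v (\<lambda>a. x a - mu a))
     (normal_density 0 (sqrt (ip p v (mv p Sf v))))"
proof -
  interpret prob_space "mvn p mu Sig" by (rule prob_space_mvn)
  define u where "u = mv p Sf v"
  define w where "w = ltv chol u"
  \<comment> \<open>Zero coefficients are dropped because \<open>sum_indep_normal\<close> asks for
    positive standard deviations.\<close>
  define I where "I = {i\<in>{0..<p}. w i \<noteq> 0}"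
  have Qu: "mv p Qf u i = v i" if "i < p" for i using mv_Qf_Sf[OF that] by (simp add: u_def)
  have "ip p w w = ip p u (mv p Qf u)" by (simp add: chol_form w_def)
  also have "\<dots> = ip p u v" by (intro ip_cong Qu refl)
  finally have ww: "ip p w w = ip p v (mv p Sf v)" by (simp add: u_def ip_commute)
  have lin: "ip p v (\<lambda>a. x a - mu a) = (\<Sum>i\<in>I. 0 + w i * whiten p chol mu x i)" for x
  proof -
    have "ip p v (\<lambda>a. x a - mu a) = ip p (mv p Qf u) (\<lambda>a. x a - mu a)" by (intro ip_cong) (auto simp: Qu)
    also have "\<dots> = ip p u (mv p Qf (\<lambda>a. x a - mu a))" by (rule ip_mv_sym[symmetric]) (rule Qf_sym)
    also have "\<dots> = ip p w (ltv chol (\<lambda>a. x a - mu a))" by (simp add: chol_form w_def)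
    also have "\<dots> = (\<Sum>i\<in>{0..<p}. w i * whiten p chol mu x i)"
      by (simp add: ip_def lessThan_atLeast0 whiten_def)
    also have "\<dots> = (\<Sum>i\<in>I. w i * whiten p chol mu x i)"
      by (intro sum.mono_neutral_right) (auto simp: I_def)
    finally show ?thesis by simp
  qed
  have "ip p w w > 0" using Sf_pos[OF v] ww by simp
  hence "\<not> (\<forall>i<p. w i = 0)" using ip_self_eq_0_iff[of p w] by simp
  hence "I \<noteq> {}" by (auto simp: I_def)
  have "p > 0" using v by auto
  have "distributed (mvn p mu Sig) lborel (\<lambda>x. \<Sum>i\<in>I. 0 + w i * whiten p chol mu x i)
      (normal_density (\<Sum>i\<in>I. 0) (sqrt (\<Sum>i\<in>I. \<bar>w i\<bar>\<^sup>2)))"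
  proof (rule sum_indep_normal)
    show "finite I" by (simp add: I_def)
    show "indep_vars (\<lambda>i. borel) (\<lambda>i x. 0 + w i * whiten p chol mu x i) I"
      by (rule indep_vars_compose2[OF indep_vars_subset[OF indep_whiten[OF \<open>p > 0\<close>]], where Y = "\<lambda>i y. 0 + w i * y"])
         (auto simp: I_def)
    show "distributed (mvn p mu Sig) lborel (\<lambda>x. 0 + w i * whiten p chol mu x i) (normal_density 0 \<bar>w i\<bar>)"
      if "i \<in> I" for i
      using normal_density_affine[OF distributed_whiten[of i], of "w i" 0] that by (simp add: I_def)
  qed (use \<open>I \<noteq> {}\<close> in \<open>auto simp: I_def\<close>)
  moreover have "(\<Sum>i\<in>I. \<bar>w i\<bar>\<^sup>2) = ip p w w"
    unfolding ip_def lessThan_atLeast0 power2_abs power2_eq_square[symmetric]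
    by (intro sum.mono_neutral_left) (auto simp: I_def)
  ultimately show ?thesis by (simp add: lin ww)
qed

end

lemma (in prob_space) normal_zero_mean_moments:
  fixes X :: "'a \<Rightarrow> real"
  assumes D: "distributed M lborel X (normal_density 0 \<sigma>)" and "0 < \<sigma>"
  shows "integrable M (\<lambda>x. X x ^ k)" "expectation X = 0" "expectation (\<lambda>x. X x ^ 2) = \<sigma>\<^sup>2"
    "expectation (\<lambda>x. X x ^ 4) = 3 * \<sigma> ^ 4"
proof -
  show "integrable M (\<lambda>x. X x ^ k)"
    using distributed_integrable[OF D, of "\<lambda>x. x ^ k"] integrable_normal_moment[OF \<open>0 < \<sigma>\<close>, of 0 k] by simp
  have e: "expectation (\<lambda>x. X x ^ k) = (\<integral>x. normal_density 0 \<sigma> x * x ^ k \<partial>lborel)" for k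
    using distributed_integral[OF D, of "\<lambda>x. x ^ k"] by simp
  show "expectation X = 0"
    using e[of 1] integral_normal_moment_odd[OF \<open>0 < \<sigma>\<close>, of 0 0] by simp
  show "expectation (\<lambda>x. X x ^ 2) = \<sigma>\<^sup>2"
  proof -
    have "(\<integral>x. normal_density 0 \<sigma> x * x ^ 2 \<partial>lborel) = fact 2 / ((2 / \<sigma>\<^sup>2) ^ 1 * fact 1)"
      using integral_normal_moment_even[OF \<open>0 < \<sigma>\<close>, of 0 1] by simp
    thus ?thesis by (simp add: e fact_numeral)
  qed
  show "expectation (\<lambda>x. X x ^ 4) = 3 * \<sigma> ^ 4"
  proof -
    have "(\<integral>x. normal_density 0 \<sigma> x * x ^ 4 \<partial>lborel) = fact 4 / ((2 / \<sigma>\<^sup>2) ^ 2 * fact 2)"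
      using integral_normal_moment_even[OF \<open>0 < \<sigma>\<close>, of 0 2] by simp
    thus ?thesis by (simp add: e fact_numeral power_divide power_mult[symmetric])
  qed
qed

section \<open>Concentration of the sample covariance\<close>

context prob_space
begin

lemma PiM_single_integral:
  fixes h :: "'a \<Rightarrow> real" and n :: nat
  assumes "i < n" "integrable M h"
  shows "integrable (PiM {0..<n} (\<lambda>_. M)) (\<lambda>X. h (X i))"
    "(\<integral>X. h (X i) \<partial>PiM {0..<n} (\<lambda>_. M)) = expectation h"
proof -
  have D: "distr (PiM {0..<n} (\<lambda>_. M)) M (\<lambda>X. X i) = M"
    using assms(1) by (intro distr_PiM_component) (auto intro: prob_space_axioms)
  have m: "(\<lambda>X. X i) \<in> measurable (PiM {0..<n} (\<lambda>_. M)) M"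
    using assms(1) by (intro measurable_component_singleton) auto
  have hm: "h \<in> borel_measurable M" using assms(2) by simp
  show "integrable (PiM {0..<n} (\<lambda>_. M)) (\<lambda>X. h (X i))"
    using assms(2) by (subst integrable_distr_eq[OF m hm, symmetric]) (simp add: D)
  show "(\<integral>X. h (X i) \<partial>PiM {0..<n} (\<lambda>_. M)) = expectation h"
    by (subst integral_distr[OF m hm, symmetric]) (simp add: D)
qed

lemma PiM_pair_integral:
  fixes f :: "'a \<Rightarrow> real" and n :: nat
  assumes "i < n" "j < n" "i \<noteq> j" and f: "integrable M f"
  shows "integrable (PiM {0..<n} (\<lambda>_. M)) (\<lambda>X. f (X i) * f (X j))"
    "(\<integral>X. f (X i) * f (X j) \<partial>PiM {0..<n} (\<lambda>_. M)) = (expectation f)\<^sup>2"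
proof -
  interpret P: product_sigma_finite "\<lambda>_::nat. M"
    by (intro product_sigma_finite.intro) (rule sigma_finite_measure_axioms)
  \<comment> \<open>Padding with the constant 1 makes the pair a product over all \<open>n\<close>
    coordinates, which Fubini factorises; the added factors have expectation 1.\<close>
  define g where "g k = (if k = i \<or> k = j then f else (\<lambda>_. 1))" for k
  have g: "integrable M (g k)" for k using f by (simp add: g_def)
  have sub: "(\<Prod>k\<in>{0..<n}. F k) = F i * F j" if "\<And>k. k \<noteq> i \<Longrightarrow> k \<noteq> j \<Longrightarrow> F k = 1" for F :: "nat \<Rightarrow> real"
  proof -
    have "(\<Prod>k\<in>{0..<n}. F k) = (\<Prod>k\<in>{i,j}. F k)"
      using assms(1,2) that by (intro prod.mono_neutral_right) auto
    thus ?thesis using assms(3) by simp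
  qed
  have e: "(\<Prod>k\<in>{0..<n}. g k (X k)) = f (X i) * f (X j)" for X
    by (subst sub) (auto simp: g_def)
  show "integrable (PiM {0..<n} (\<lambda>_. M)) (\<lambda>X. f (X i) * f (X j))"
    using P.product_integrable_prod[of "{0..<n}" g] g by (simp add: e)
  have "(\<integral>X. f (X i) * f (X j) \<partial>PiM {0..<n} (\<lambda>_. M)) = (\<Prod>k\<in>{0..<n}. expectation (g k))"
    using P.product_integral_prod[of "{0..<n}" g] g by (simp add: e)
  also have "\<dots> = expectation f * expectation f"
    by (subst sub) (auto simp: g_def prob_space)
  finally show "(\<integral>X. f (X i) * f (X j) \<partial>PiM {0..<n} (\<lambda>_. M)) = (expectation f)\<^sup>2"
    by (simp add: power2_eq_square)
qed

text \<open>After expanding the square, independence and centring kill all off-diagonal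
  pairs.\<close>

lemma PiM_sum_second_moment:
  fixes f :: "'a \<Rightarrow> real" and n :: nat
  assumes f: "integrable M f" "expectation f = 0" "integrable M (\<lambda>x. (f x)\<^sup>2)"
  shows "integrable (PiM {0..<n} (\<lambda>_. M)) (\<lambda>X. (\<Sum>i<n. f (X i))\<^sup>2)"
    "(\<integral>X. (\<Sum>i<n. f (X i))\<^sup>2 \<partial>PiM {0..<n} (\<lambda>_. M)) = n * expectation (\<lambda>x. (f x)\<^sup>2)"
proof -
  let ?P = "PiM {0..<n} (\<lambda>_::nat. M)"
  have sq: "(\<Sum>i<n. f (X i))\<^sup>2 = (\<Sum>i<n. \<Sum>j<n. f (X i) * f (X j))" for X
    by (simp add: power2_eq_square sum_product)
  have int: "integrable ?P (\<lambda>X. f (X i) * f (X j))"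
    and val: "(\<integral>X. f (X i) * f (X j) \<partial>?P) = (if i = j then expectation (\<lambda>x. (f x)\<^sup>2) else 0)"
    if "i < n" "j < n" for i j
    using PiM_pair_integral[OF that _ f(1)] PiM_single_integral[OF that(1) f(3)] f(2)
    by (cases "i = j"; simp add: power2_eq_square)+
  show "integrable ?P (\<lambda>X. (\<Sum>i<n. f (X i))\<^sup>2)"
    unfolding sq by (intro Bochner_Integration.integrable_sum int) auto
  have "(\<integral>X. (\<Sum>i<n. f (X i))\<^sup>2 \<partial>?P) = (\<Sum>i<n. \<Sum>j<n. \<integral>X. f (X i) * f (X j) \<partial>?P)"
    unfolding sq
    by (subst Bochner_Integration.integral_sum, (intro Bochner_Integration.integrable_sum int; simp))
       (intro sum.cong refl Bochner_Integration.integral_sum int; simp)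
  also have "\<dots> = (\<Sum>i<n. \<Sum>j<n. if j = i then expectation (\<lambda>x. (f x)\<^sup>2) else 0)"
    by (intro sum.cong refl) (auto simp: val)
  finally show "(\<integral>X. (\<Sum>i<n. f (X i))\<^sup>2 \<partial>?P) = n * expectation (\<lambda>x. (f x)\<^sup>2)"
    by simp
qed

lemma PiM_sum_Chebyshev:
  fixes f :: "'a \<Rightarrow> real" and n :: nat and \<epsilon> :: real
  assumes f: "integrable M f" "expectation f = 0" "integrable M (\<lambda>x. (f x)\<^sup>2)"
    and V: "expectation (\<lambda>x. (f x)\<^sup>2) \<le> V" and "0 < \<epsilon>" "0 < n"
  shows "{X \<in> space (PiM {0..<n} (\<lambda>_. M)). \<epsilon> * n \<le> \<bar>\<Sum>i<n. f (X i)\<bar>} \<in> sets (PiM {0..<n} (\<lambda>_. M))"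
    "measure (PiM {0..<n} (\<lambda>_. M)) {X \<in> space (PiM {0..<n} (\<lambda>_. M)). \<epsilon> * n \<le> \<bar>\<Sum>i<n. f (X i)\<bar>}
       \<le> V / (\<epsilon>\<^sup>2 * n)"
proof -
  let ?P = "PiM {0..<n} (\<lambda>_::nat. M)"
  interpret P: prob_space ?P by (intro prob_space_PiM prob_space_axioms)
  have m: "(\<lambda>X. \<Sum>i<n. f (X i)) \<in> borel_measurable ?P"
    using PiM_single_integral(1)[OF _ f(1)] by (intro borel_measurable_sum borel_measurable_integrable) auto
  note m[measurable]
  show "{X \<in> space ?P. \<epsilon> * n \<le> \<bar>\<Sum>i<n. f (X i)\<bar>} \<in> sets ?P" by measurable
  have "measure ?P {X \<in> space ?P. \<epsilon> * n \<le> \<bar>\<Sum>i<n. f (X i)\<bar>}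
      \<le> (\<integral>X. (\<Sum>i<n. f (X i))\<^sup>2 \<partial>?P) / (\<epsilon> * n)\<^sup>2"
    using assms by (intro P.second_moment_method m PiM_sum_second_moment) auto
  also have "\<dots> = expectation (\<lambda>x. (f x)\<^sup>2) / (\<epsilon>\<^sup>2 * n)"
    using assms by (subst PiM_sum_second_moment(2)[OF f]) (simp add: power2_eq_square)
  also have "\<dots> \<le> V / (\<epsilon>\<^sup>2 * n)" using V by (intro divide_right_mono) auto
  finally show "measure ?P {X \<in> space ?P. \<epsilon> * n \<le> \<bar>\<Sum>i<n. f (X i)\<bar>} \<le> V / (\<epsilon>\<^sup>2 * n)" .
qed

end

section \<open>Centred products of normal linear forms\<close>

context gaussian_vector
begin

abbreviation "N \<equiv> mvn p mu Sig"

definition lin :: "(nat \<Rightarrow> real) \<Rightarrow> (nat \<Rightarrow> real) \<Rightarrow> real" where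
  "lin e x = ip p e (\<lambda>a. x a - mu a)"

lemma lin_moments:
  assumes e: "ip p e (mv p Sf e) = s" "0 < s"
  shows "integrable N (\<lambda>x. lin e x ^ k)" "(\<integral>x. lin e x \<partial>N) = 0" "(\<integral>x. (lin e x)\<^sup>2 \<partial>N) = s"
    "(\<integral>x. lin e x ^ 4 \<partial>N) = 3 * s\<^sup>2"
proof -
  interpret prob_space N by (rule prob_space_mvn)
  have "\<exists>i<p. e i \<noteq> 0"
  proof (rule ccontr)
    assume "\<not> (\<exists>i<p. e i \<noteq> 0)"
    hence "ip p e (mv p Sf e) = 0" by (simp add: ip_def)
    with e show False by simp
  qed
  from distributed_linear_form[OF this]
  have D: "distributed N lborel (lin e) (normal_density 0 (sqrt s))" by (simp add: lin_def[abs_def] e(1))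
  have s: "0 < sqrt s" using e(2) by simp
  have "sqrt s ^ 4 = ((sqrt s)\<^sup>2)\<^sup>2" by (simp only: power_mult[symmetric]) simp
  hence "sqrt s ^ 4 = s\<^sup>2" using e(2) by simp
  thus "integrable N (\<lambda>x. lin e x ^ k)" "(\<integral>x. lin e x \<partial>N) = 0" "(\<integral>x. (lin e x)\<^sup>2 \<partial>N) = s"
    "(\<integral>x. lin e x ^ 4 \<partial>N) = 3 * s\<^sup>2"
    using normal_zero_mean_moments[OF D s] e(2) by simp_all
qed

text \<open>Input for Chebyshev on the entries of the empirical Gram matrix: \<open>c\<close> is 0
  for two different spiked directions and 1 for a repeated one. Only laws of single linear forms are
  used, never a joint law.\<close>

lemma lin_product_centered:
  assumes e: "ip p e (mv p Sf e) = 1" and e': "ip p e' (mv p Sf e') = 1"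
    and c: "ip p e (mv p Sf e') = c" "c = 0 \<or> c = 1 \<and> e' = e"
  defines "f \<equiv> \<lambda>x. lin e x * lin e' x - c"
  shows "integrable N f" "(\<integral>x. f x \<partial>N) = 0" "integrable N (\<lambda>x. (f x)\<^sup>2)" "(\<integral>x. (f x)\<^sup>2 \<partial>N) \<le> 3"
proof -
  interpret prob_space N by (rule prob_space_mvn)
  have one: "prob (space L) = 1" using prob_space by simp
  note m = lin_moments[OF e, simplified] and m' = lin_moments[OF e', simplified]
  have i2: "integrable N (\<lambda>x. (lin e x)\<^sup>2)" and i4: "integrable N (\<lambda>x. lin e x ^ 4)"
    by (rule m(1))+
  have i2': "integrable N (\<lambda>x. (lin e' x)\<^sup>2)" and i4': "integrable N (\<lambda>x. lin e' x ^ 4)"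
    by (rule m'(1))+
  have i1: "integrable N (lin e)" "integrable N (lin e')" using m(1)[of 1] m'(1)[of 1] by simp_all
  have [measurable]: "lin e \<in> borel_measurable N" "lin e' \<in> borel_measurable N" using i1 by auto
  have prod: "integrable N (\<lambda>x. lin e x * lin e' x) \<and> (\<integral>x. lin e x * lin e' x \<partial>N) = c"
  proof (cases "c = 0")
    case True
    \<comment> \<open>Polarisation: the product is half of the square of the sum minus both squares.
      For uncorrelated forms the sum has variance 2, so the expectation is 0.\<close>
    define s where "s = (\<lambda>a. e a + e' a)"
    have "ip p e' (mv p Sf e) = ip p e (mv p Sf e')"
      using ip_mv_sym[of p Sf e' e, OF Sig_sym] by (simp add: ip_commute)
    hence "ip p s (mv p Sf s) = 2"
      using e e' c(1) True by (simp add: s_def mv_add ip_linear)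
    note ms = lin_moments[OF this, simplified]
    have eq: "lin e x * lin e' x = ((lin s x)\<^sup>2 - (lin e x)\<^sup>2 - (lin e' x)\<^sup>2) / 2" for x
    proof -
      have "lin s x = lin e x + lin e' x" by (simp add: lin_def s_def ip_linear)
      thus ?thesis by (simp add: power2_eq_square algebra_simps)
    qed
    show ?thesis unfolding eq using i2 i2' ms(1)[of 2] True m(3) m'(3) ms(3) by simp
  next
    case False
    thus ?thesis using c i2 m(3) by (simp add: power2_eq_square)
  qed
  show "integrable N f" "(\<integral>x. f x \<partial>N) = 0"
    unfolding f_def using prod one by simp_all
  \<comment> \<open>The arithmetic-geometric mean inequality reduces the squared product to fourth
    moments, each equal to 3.\<close>
  have bnd: "(lin e x * lin e' x)\<^sup>2 \<le> (lin e x ^ 4 + lin e' x ^ 4) / 2" for x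
  proof -
    have "0 \<le> ((lin e x)\<^sup>2 - (lin e' x)\<^sup>2)\<^sup>2" by simp
    thus ?thesis by (simp add: power2_eq_square power4_eq_xxxx algebra_simps)
  qed
  have isq: "integrable N (\<lambda>x. (lin e x * lin e' x)\<^sup>2)"
    by (rule Bochner_Integration.integrable_bound[where f = "\<lambda>x. (lin e x ^ 4 + lin e' x ^ 4) / 2"])
       (use i4 i4' bnd in \<open>auto intro!: AE_I2 intro: order_trans\<close>)
  have f2: "(f x)\<^sup>2 = (lin e x * lin e' x)\<^sup>2 - 2 * c * (lin e x * lin e' x) + c\<^sup>2" for x
    by (simp add: f_def power2_eq_square algebra_simps)
  show "integrable N (\<lambda>x. (f x)\<^sup>2)" unfolding f2 using isq prod by simp
  have "(\<integral>x. (f x)\<^sup>2 \<partial>N) = (\<integral>x. (lin e x * lin e' x)\<^sup>2 \<partial>N) - 2 * c * c + c\<^sup>2"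
    unfolding f2 using isq prod one by simp
  also have "\<dots> \<le> (\<integral>x. (lin e x * lin e' x)\<^sup>2 \<partial>N)"
    by (simp add: power2_eq_square)
  also have "\<dots> \<le> (\<integral>x. (lin e x ^ 4 + lin e' x ^ 4) / 2 \<partial>N)"
    using isq i4 i4' bnd by (intro integral_mono) auto
  also have "\<dots> = 3" using i4 i4' m(4) m'(4) by simp
  finally show "(\<integral>x. (f x)\<^sup>2 \<partial>N) \<le> 3" .
qed

end

text \<open>Entrywise errors \<open>\<epsilon> * n\<close> change the form by at most
  \<open>(\<Sum>j<d. \<bar>b j\<bar>)\<^sup>2 * \<epsilon> * n\<close>, and Cauchy-Schwarz bounds
  the square by \<open>d\<close> times the sum of squares. With
  \<open>\<epsilon> = 1 / (4 * d)\<close> the Gram error and the mean correction cost a quarter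
  each, which leaves one half.\<close>

lemma empirical_gram_lower_bound:
  fixes n d :: nat and Y :: "nat \<Rightarrow> nat \<Rightarrow> real" and b :: "nat \<Rightarrow> real"
  assumes "n \<ge> 1" "d \<ge> 1"
    and gram: "\<And>j k. j < d \<Longrightarrow> k < d \<Longrightarrow>
      \<bar>\<Sum>i<n. Y i j * Y i k - (if j = k then 1 else 0)\<bar> \<le> 1 / (4 * real d) * n"
    and mean: "\<And>j. j < d \<Longrightarrow> \<bar>\<Sum>i<n. Y i j\<bar> \<le> 1 / (4 * real d) * n"
  shows "n * (\<Sum>j<d. (b j)\<^sup>2) / 2
    \<le> (\<Sum>i<n. (\<Sum>j<d. b j * Y i j)\<^sup>2) - (\<Sum>i<n. \<Sum>j<d. b j * Y i j)\<^sup>2 / n"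
proof -
  define \<epsilon> where "\<epsilon> = 1 / (4 * real d)"
  define s where "s = (\<Sum>j<d. \<bar>b j\<bar>)"
  define B where "B = (\<Sum>j<d. (b j)\<^sup>2)"
  have eps: "0 < \<epsilon>" "\<epsilon> \<le> 1" "\<epsilon> * d = 1 / 4" using \<open>d \<ge> 1\<close> by (auto simp: \<epsilon>_def field_simps)
  have s: "s\<^sup>2 \<le> d * B"
    using sum_squared_le_sum_of_squares[of "\<lambda>j. \<bar>b j\<bar>" "{..<d}"] by (simp add: s_def B_def mult.commute)
  define U where "U j k = (\<Sum>i<n. Y i j * Y i k - (if j = k then 1 else 0))" for j k
  have "(\<Sum>i<n. (\<Sum>j<d. b j * Y i j)\<^sup>2) = (\<Sum>i<n. \<Sum>j<d. \<Sum>k<d. b j * b k * (Y i j * Y i k))"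
    by (simp add: power2_eq_square sum_product ac_simps)
  also have "\<dots> = (\<Sum>j<d. \<Sum>i<n. \<Sum>k<d. b j * b k * (Y i j * Y i k))" by (rule sum.swap)
  also have "\<dots> = (\<Sum>j<d. \<Sum>k<d. \<Sum>i<n. b j * b k * (Y i j * Y i k))"
    by (rule sum.cong[OF refl], rule sum.swap)
  also have "\<dots> = (\<Sum>j<d. \<Sum>k<d. b j * b k * U j k + (if k = j then n * (b j)\<^sup>2 else 0))"
    by (intro sum.cong refl)
       (auto simp: U_def sum_subtractf sum_distrib_left[symmetric] algebra_simps power2_eq_square)
  also have "\<dots> = (\<Sum>j<d. \<Sum>k<d. b j * b k * U j k) + n * B"
    by (simp add: sum.distrib B_def sum_distrib_left)
  finally have 1: "(\<Sum>i<n. (\<Sum>j<d. b j * Y i j)\<^sup>2) = (\<Sum>j<d. \<Sum>k<d. b j * b k * U j k) + n * B" .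
  have "\<bar>\<Sum>j<d. \<Sum>k<d. b j * b k * U j k\<bar> \<le> (\<Sum>j<d. \<Sum>k<d. \<bar>b j\<bar> * \<bar>b k\<bar> * (\<epsilon> * n))"
  proof -
    have "\<bar>b j * b k * U j k\<bar> \<le> \<bar>b j\<bar> * \<bar>b k\<bar> * (\<epsilon> * n)" if "j < d" "k < d" for j k
      unfolding abs_mult U_def \<epsilon>_def by (intro mult_left_mono gram that) auto
    thus ?thesis by (intro order_trans[OF sum_abs] sum_mono) auto
  qed
  also have "\<dots> = s * s * (\<epsilon> * n)"
    unfolding s_def sum_product by (simp only: sum_distrib_right)
  also have "\<dots> = s\<^sup>2 * (\<epsilon> * n)" by (simp add: power2_eq_square)
  also have "\<dots> \<le> d * B * (\<epsilon> * n)" using s eps by (intro mult_right_mono) auto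
  also have "\<dots> = n * B / 4" using eps(3) by (simp add: field_simps)
  finally have 2: "\<bar>\<Sum>j<d. \<Sum>k<d. b j * b k * U j k\<bar> \<le> n * B / 4" .
  have "(\<Sum>i<n. \<Sum>j<d. b j * Y i j) = (\<Sum>j<d. b j * (\<Sum>i<n. Y i j))"
    by (subst sum.swap) (simp add: sum_distrib_left)
  have "\<bar>\<Sum>i<n. \<Sum>j<d. b j * Y i j\<bar> \<le> (\<Sum>j<d. \<bar>b j\<bar> * (\<epsilon> * n))"
  proof -
    have "\<bar>b j * (\<Sum>i<n. Y i j)\<bar> \<le> \<bar>b j\<bar> * (\<epsilon> * n)" if "j < d" for j
      unfolding abs_mult \<epsilon>_def by (intro mult_left_mono mean that) auto
    hence "\<bar>\<Sum>j<d. b j * (\<Sum>i<n. Y i j)\<bar> \<le> (\<Sum>j<d. \<bar>b j\<bar> * (\<epsilon> * n))"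
      by (intro order_trans[OF sum_abs] sum_mono) auto
    thus ?thesis by (simp add: \<open>(\<Sum>i<n. \<Sum>j<d. b j * Y i j) = _\<close>)
  qed
  also have "\<dots> = s * (\<epsilon> * n)" by (simp add: s_def sum_distrib_right)
  finally have "(\<Sum>i<n. \<Sum>j<d. b j * Y i j)\<^sup>2 \<le> (s * (\<epsilon> * n))\<^sup>2"
    by (rule power2_le_iff_abs_le[THEN iffD2, rotated]) (auto simp: s_def eps less_imp_le intro!: mult_nonneg_nonneg sum_nonneg)
  hence "(\<Sum>i<n. \<Sum>j<d. b j * Y i j)\<^sup>2 / n \<le> (s * (\<epsilon> * n))\<^sup>2 / n" by (intro divide_right_mono) auto
  also have "\<dots> = s\<^sup>2 * \<epsilon> * (\<epsilon> * n)" using \<open>n \<ge> 1\<close> by (simp add: power2_eq_square field_simps)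
  \<comment> \<open>One of the two factors \<open>\<epsilon>\<close> is given away, so that the
    correction is bounded exactly like the Gram error.\<close>
  also have "\<dots> \<le> s\<^sup>2 * 1 * (\<epsilon> * n)" using eps by (intro mult_right_mono mult_left_mono) auto
  also have "\<dots> \<le> d * B * (\<epsilon> * n)" unfolding mult_1_right using s eps by (intro mult_right_mono) auto
  also have "\<dots> = n * B / 4" using eps(3) by (simp add: field_simps)
  finally have "(\<Sum>i<n. \<Sum>j<d. b j * Y i j)\<^sup>2 / n \<le> n * B / 4" .
  thus ?thesis using 1 2 unfolding B_def[symmetric] by linarith
qed

section \<open>The quadratic form of the sample covariance\<close>

lemma sample_cov_sym: "sym_mat p (sample_cov n p X)"
  unfolding sym_mat_def sample_cov_def
  by (auto intro!: eq_matI sum.cong simp: mult.commute)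

lemma sample_cov_form:
  "ip p x (mv p (\<lambda>a b. sample_cov n p X $$ (a,b)) x)
     = 1 / (real n - 1) * (\<Sum>i<n. (ip p x (\<lambda>a. X i a - sample_mean n X a))\<^sup>2)"
proof -
  let ?z = "\<lambda>i a. X i a - sample_mean n X a"
  have "ip p x (mv p (\<lambda>a b. sample_cov n p X $$ (a,b)) x)
      = (\<Sum>a<p. \<Sum>b<p. \<Sum>i<n. 1 / (real n - 1) * ((x a * ?z i a) * (x b * ?z i b)))"
    unfolding ip_mv
    by (intro sum.cong refl) (simp add: sample_cov_def sum_distrib_left sum_distrib_right ac_simps)
  also have "\<dots> = (\<Sum>a<p. \<Sum>i<n. \<Sum>b<p. 1 / (real n - 1) * ((x a * ?z i a) * (x b * ?z i b)))"
    by (rule sum.cong[OF refl], rule sum.swap)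
  also have "\<dots> = (\<Sum>i<n. \<Sum>a<p. \<Sum>b<p. 1 / (real n - 1) * ((x a * ?z i a) * (x b * ?z i b)))"
    by (rule sum.swap)
  also have "\<dots> = 1 / (real n - 1) * (\<Sum>i<n. (ip p x (?z i))\<^sup>2)"
    unfolding power2_eq_square ip_def sum_product by (simp only: sum_distrib_left)
  finally show ?thesis .
qed

text \<open>For \<open>n = 0\<close> the prefactor is -1 but the sum is empty, and for
  \<open>n = 1\<close> the prefactor is \<open>1 / 0 = 0\<close>. So semidefiniteness holds for
  every \<open>n\<close>, as measurability for every \<open>n\<close> demands.\<close>

lemma sample_cov_psd: "0 \<le> ip p x (mv p (\<lambda>a b. sample_cov n p X $$ (a,b)) x)"
  unfolding sample_cov_form
  by (cases "n = 0") (auto intro!: divide_nonneg_nonneg sum_nonneg simp: Suc_le_eq)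

text \<open>Recentring at any \<open>m\<close> costs only the square of the total sum. With the true
  mean as \<open>m\<close> the summands become functions of single observations, hence
  independent.\<close>

lemma sample_cov_form_centered:
  assumes "n \<ge> 1"
  shows "ip p x (mv p (\<lambda>a b. sample_cov n p X $$ (a,b)) x)
     = 1 / (real n - 1) * ((\<Sum>i<n. (ip p x (\<lambda>a. X i a - m a))\<^sup>2) - (\<Sum>i<n. ip p x (\<lambda>a. X i a - m a))\<^sup>2 / n)"
proof -
  define h where "h i = ip p x (\<lambda>a. X i a - m a)" for i
  define H where "H = (\<Sum>i<n. h i)"
  have n0: "real n \<noteq> 0" using assms by simp
  have "H = (\<Sum>a<p. x a * (n * sample_mean n X a - n * m a))"
    unfolding H_def h_def ip_def
    by (subst sum.swap) (use n0 in \<open>simp add: sample_mean_def sum_distrib_left[symmetric] sum_subtractf\<close>)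
  also have "\<dots> = n * ip p x (\<lambda>a. sample_mean n X a - m a)"
    by (simp add: ip_def sum_distrib_left algebra_simps)
  finally have "ip p x (\<lambda>a. sample_mean n X a - m a) = H / n" using n0 by simp
  hence z: "ip p x (\<lambda>a. X i a - sample_mean n X a) = h i - H / n" for i
    by (simp add: h_def ip_diff_right)
  have "(\<Sum>i<n. (h i - c)\<^sup>2) = (\<Sum>i<n. (h i)\<^sup>2) - 2 * c * H + n * c\<^sup>2" for c :: real
    by (simp add: power2_diff sum.distrib sum_subtractf H_def sum_distrib_left sum_distrib_right ac_simps)
  hence "(\<Sum>i<n. (h i - H / n)\<^sup>2) = (\<Sum>i<n. (h i)\<^sup>2) - 2 * (H / n) * H + n * (H / n)\<^sup>2" .
  also have "\<dots> = (\<Sum>i<n. (h i)\<^sup>2) - H\<^sup>2 / n"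
    using n0 by (simp add: power2_eq_square field_simps)
  finally show ?thesis unfolding sample_cov_form z h_def[symmetric] H_def[symmetric] by simp
qed

context gaussian_vector
begin

lemma sample_measure_eq: "sample_measure n p mu Sig = PiM {0..<n} (\<lambda>_. N)"
  by (simp add: sample_measure_def)

lemma measurable_sample_entry:
  assumes "i < n" "j < p"
  shows "(\<lambda>X. X i j) \<in> borel_measurable (sample_measure n p mu Sig)"
proof -
  have "(\<lambda>X. X i) \<in> measurable (sample_measure n p mu Sig) N"
    unfolding sample_measure_eq using assms by (intro measurable_component_singleton) auto
  moreover have "(\<lambda>x. x j) \<in> measurable N borel"
    using measurable_component_singleton[of j "{0..<p}" "\<lambda>_. lborel :: real measure"] assms
    by (simp add: measurable_cong_sets[OF sets_mvn refl])
  ultimately show ?thesis by (rule measurable_compose)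
qed

lemma measurable_sample_cov_eigval:
  assumes "k < p"
  shows "(\<lambda>X. eigvals_desc (sample_cov n p X) ! k) \<in> borel_measurable (sample_measure n p mu Sig)"
proof (rule measurable_eigvals_desc[OF sample_cov_sym sample_cov_psd _ assms])
  fix a b assume ab: "a < p" "b < p"
  have [measurable]: "(\<lambda>X. X i a) \<in> borel_measurable (sample_measure n p mu Sig)"
    "(\<lambda>X. X i b) \<in> borel_measurable (sample_measure n p mu Sig)" if "i \<in> {..<n}" for i
    using measurable_sample_entry ab that by auto
  show "(\<lambda>X. sample_cov n p X $$ (a, b)) \<in> borel_measurable (sample_measure n p mu Sig)"
    unfolding sample_cov_def sample_mean_def using ab by simp measurable
qed

lemma measurable_g_stat:
  "(\<lambda>X. g_stat n p X k) \<in> borel_measurable (sample_measure n p mu Sig)"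
proof -
  have dim: "dim_row (sample_cov n p X) = p" for X by (simp add: sample_cov_def)
  have [measurable]: "(\<lambda>X. \<Sum>i\<in>{p - r..<p}. (eigvals_desc (sample_cov n p X) ! i) ^ l)
      \<in> borel_measurable (sample_measure n p mu Sig)" for r l
    by (intro borel_measurable_sum borel_measurable_power measurable_sample_cov_eigval) auto
  show ?thesis
    unfolding g_stat_def T_stat_def Let_def moment_small_def dim by measurable
qed

text \<open>The exceptional set collects the Gram entries (\<open>E\<close>), the means
  (\<open>F\<close>) and the bulk energy (\<open>G\<close>), all in coordinates along eigenvectors
  of \<open>Sig\<close> scaled to unit variance. Outside it both conclusions are deterministic; a
  union bound gives the probability.\<close>

lemma sample_concentration:
  assumes n: "2 \<le> n" and d: "1 \<le> d" "d \<le> p" and K: "0 < K"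
    and spike: "0 < eigvals_desc Sig ! (d - 1)"
    and bulk: "\<And>j. d \<le> j \<Longrightarrow> j < p \<Longrightarrow> eigvals_desc Sig ! j = s2" "0 < s2"
  shows "\<exists>B\<in>sets (sample_measure n p mu Sig).
    measure (sample_measure n p mu Sig) B \<le> 1 / K + (48 * real d ^ 4 + 16 * real d ^ 3) / n \<and>
    (\<forall>X\<in>space (sample_measure n p mu Sig) - B.
       eigvals_desc Sig ! (d - 1) / 2 \<le> eigvals_desc (sample_cov n p X) ! (d - 1) \<and>
       (\<Sum>i\<in>{d..<p}. eigvals_desc (sample_cov n p X) ! i) \<le> 2 * s2 * K * p)"
proof -
  let ?P = "PiM {0..<n} (\<lambda>_::nat. N)"
  interpret N: prob_space N by (rule prob_space_mvn)
  interpret P: prob_space ?P by (intro prob_space_PiM N.prob_space_axioms)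
  have symS: "sym_mat p Sig" using pd by (simp add: pos_def_mat_def)
  define l where "l j = eigvals_desc Sig ! j" for j
  obtain v where v: "length (eigvals_desc Sig) = p" "sorted_wrt (\<ge>) (eigvals_desc Sig)"
    "orthonormal_upto p p v"
    "\<forall>a<p. \<forall>b<p. Sig $$ (a,b) = (\<Sum>i<p. eigvals_desc Sig ! i * v i a * v i b)"
    by (rule spectral_decomposition[OF symS])
  have l_ge: "l (d - 1) \<le> l j" if "j < d" for j
    unfolding l_def using that d by (intro eigvals_desc_decreasing[OF symS]) auto
  have l_pos: "0 < l j" if "j < p" for j
    using that spike bulk l_ge[of j] by (cases "j < d") (auto simp: l_def)
  have Sfv: "Sf a b = (\<Sum>i<p. l i * v i a * v i b)" if "a < p" "b < p" for a b
    using v(4) that by (simp add: Sf_def l_def)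
  \<comment> \<open>Division by \<open>sqrt (l j)\<close> gives the linear form along
    \<open>v j\<close> variance one; different \<open>j\<close> are uncorrelated, as recorded in
    \<open>ee\<close>.\<close>
  define e where "e j = (\<lambda>a. (1 / sqrt (l j)) * v j a)" for j
  have ee: "ip p (e j) (mv p Sf (e k)) = (if j = k then 1 else 0)" if "j < p" "k < p" for j k
  proof -
    have "ip p (e j) (mv p Sf (e k)) = (1 / sqrt (l j)) * ((1 / sqrt (l k)) * ip p (v j) (mv p Sf (v k)))"
      unfolding e_def mv_scale ip_scale_left ip_scale_right by simp
    also have "ip p (v j) (mv p Sf (v k)) = (if j = k then l j else 0)"
      by (rule quadratic_form_eigenvector[OF v(3) Sfv that])
    finally show ?thesis using l_pos[OF that(1)] by (auto simp: field_simps)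
  qed
  have ve: "ip p (v j) (\<lambda>a. x a - mu a) = sqrt (l j) * lin (e j) x" if "j < p" for j x
    unfolding lin_def e_def ip_scale_left using l_pos[OF that] by simp
  \<comment> \<open>The tolerance demanded by \<open>empirical_gram_lower_bound\<close>.\<close>
  define eps where "eps = 1 / (4 * real d)"
  have eps: "0 < eps" using d by (simp add: eps_def)
  have n0: "0 < n" using n by simp
  define E where "E jk = {X \<in> space ?P. eps * n \<le>
    \<bar>\<Sum>i<n. lin (e (fst jk)) (X i) * lin (e (snd jk)) (X i) - (if fst jk = snd jk then 1 else 0)\<bar>}"
    for jk :: "nat \<times> nat"
  define F where "F j = {X \<in> space ?P. eps * n \<le> \<bar>\<Sum>i<n. lin (e j) (X i)\<bar>}" for j
  define Z where "Z X = (\<Sum>i<n. \<Sum>j\<in>{d..<p}. (lin (e j) (X i))\<^sup>2)" for X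
  \<comment> \<open>\<open>Z\<close> has mean \<open>n * (p - d)\<close>, at most
    \<open>n * p\<close>, so this threshold makes the Markov bound \<open>1 / K\<close>.\<close>
  define G where "G = {X \<in> space ?P. K * n * p \<le> Z X}"
  define B where "B = G \<union> (\<Union>jk\<in>{..<d} \<times> {..<d}. E jk) \<union> (\<Union>j<d. F j)"
  have E: "E jk \<in> sets ?P \<and> measure ?P (E jk) \<le> 3 / (eps\<^sup>2 * n)" if "jk \<in> {..<d} \<times> {..<d}" for jk
  proof -
    have jk: "fst jk < p" "snd jk < p" using that d by auto
    have e1: "ip p (e (fst jk)) (mv p Sf (e (fst jk))) = 1" and e2: "ip p (e (snd jk)) (mv p Sf (e (snd jk))) = 1"
      using ee jk by simp_all
    have "(if fst jk = snd jk then 1 else 0 :: real) = 0 \<or>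
        (if fst jk = snd jk then 1 else 0 :: real) = 1 \<and> e (snd jk) = e (fst jk)" by simp
    from N.PiM_sum_Chebyshev[OF lin_product_centered[OF e1 e2 ee[OF jk] this] eps n0]
    show ?thesis unfolding E_def by (rule conjI)
  qed
  have F: "F j \<in> sets ?P \<and> measure ?P (F j) \<le> 1 / (eps\<^sup>2 * n)" if "j < d" for j
  proof -
    have "ip p (e j) (mv p Sf (e j)) = 1" using ee[of j j] that d by simp
    note m = lin_moments[OF this, simplified]
    from N.PiM_sum_Chebyshev[OF m(1)[of 1, simplified] m(2) m(1)[of 2] eq_refl[OF m(3)] eps n0]
    show ?thesis unfolding F_def by (rule conjI)
  qed
  have G: "G \<in> sets ?P \<and> measure ?P G \<le> 1 / K"
  proof -
    have m: "integrable N (\<lambda>x. (lin (e j) x)\<^sup>2)" "(\<integral>x. (lin (e j) x)\<^sup>2 \<partial>N) = 1" if "j \<in> {d..<p}" for j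
      using lin_moments[of "e j" 1] ee[of j j] that by auto
    have "integrable ?P (\<lambda>X. (lin (e j) (X i))\<^sup>2)" "(\<integral>X. (lin (e j) (X i))\<^sup>2 \<partial>?P) = 1"
      if "j \<in> {d..<p}" "i \<in> {..<n}" for i j
      using N.PiM_single_integral[OF _ m(1)[OF that(1)], of i n] m(2)[OF that(1)] that(2) by auto
    note m = this
    have iZ: "integrable ?P Z"
      unfolding Z_def[abs_def] by (intro Bochner_Integration.integrable_sum m)
    have "(\<integral>X. Z X \<partial>?P) = (\<Sum>i<n. \<Sum>j\<in>{d..<p}. \<integral>X. (lin (e j) (X i))\<^sup>2 \<partial>?P)"
      unfolding Z_def
      by (subst Bochner_Integration.integral_sum, (intro Bochner_Integration.integrable_sum m; simp))
         (intro sum.cong refl Bochner_Integration.integral_sum m; simp)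
    also have "\<dots> = (\<Sum>i<n. \<Sum>j\<in>{d..<p}. 1)"
      by (intro sum.cong refl m)
    finally have vZ: "(\<integral>X. Z X \<partial>?P) = n * (real p - real d)" using d by (simp add: of_nat_diff)
    have Gs: "G \<in> sets ?P" unfolding G_def using iZ by measurable
    have "0 \<le> Z X" for X unfolding Z_def by (intro sum_nonneg) auto
    hence "measure ?P G \<le> (\<integral>X. Z X \<partial>?P) / (K * n * p)"
      unfolding G_def using iZ Gs K n0 d
      by (intro integral_Markov_inequality_measure[where A = G]) auto
    also have "\<dots> \<le> n * p / (K * n * p)"
      unfolding vZ using K by (intro divide_right_mono) (auto intro!: mult_left_mono)
    also have "\<dots> = 1 / K" using n0 d by simp
    finally show ?thesis using Gs by simp
  qed
  have Bs: "B \<in> sets ?P" unfolding B_def using E F G by (intro sets.Un sets.finite_UN) auto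
  have "measure ?P B \<le> measure ?P G + measure ?P (\<Union>jk\<in>{..<d} \<times> {..<d}. E jk) + measure ?P (\<Union>j<d. F j)"
    unfolding B_def using E F G
    by (intro order_trans[OF measure_Un_le] add_mono order_refl) (auto intro!: sets.finite_UN)
  also have "\<dots> \<le> 1 / K + (\<Sum>jk\<in>{..<d} \<times> {..<d}. 3 / (eps\<^sup>2 * n)) + (\<Sum>j<d. 1 / (eps\<^sup>2 * n))"
  proof (intro add_mono)
    show "measure ?P G \<le> 1 / K" using G by simp
    show "measure ?P (\<Union>jk\<in>{..<d} \<times> {..<d}. E jk) \<le> (\<Sum>jk\<in>{..<d} \<times> {..<d}. 3 / (eps\<^sup>2 * n))"
      by (rule order_trans[OF measure_UNION_le sum_mono]) (use E in auto)
    show "measure ?P (\<Union>j<d. F j) \<le> (\<Sum>j<d. 1 / (eps\<^sup>2 * n))"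
      by (rule order_trans[OF measure_UNION_le sum_mono]) (use F in auto)
  qed
  \<comment> \<open>\<open>1 / eps\<^sup>2\<close> is \<open>16 * d\<^sup>2\<close>; it enters with
    factor 3 for each of \<open>d\<^sup>2\<close> pairs and with factor 1 for each of
    \<open>d\<close> means.\<close>
  also have "\<dots> = 1 / K + (48 * real d ^ 4 + 16 * real d ^ 3) / n"
    using d n0 by (simp add: eps_def field_simps power2_eq_square power4_eq_xxxx power3_eq_cube)
  finally have Bm: "measure ?P B \<le> 1 / K + (48 * real d ^ 4 + 16 * real d ^ 3) / n" .
  have good: "l (d - 1) / 2 \<le> eigvals_desc (sample_cov n p X) ! (d - 1) \<and>
       (\<Sum>i\<in>{d..<p}. eigvals_desc (sample_cov n p X) ! i) \<le> 2 * s2 * K * p"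
    if X: "X \<in> space ?P - B" for X
  proof -
    define S where "S = sample_cov n p X"
    define Y where "Y i j = lin (e j) (X i)" for i j
    have symX: "sym_mat p S" unfolding S_def by (rule sample_cov_sym)
    obtain u where u: "length (eigvals_desc S) = p" "sorted_wrt (\<ge>) (eigvals_desc S)"
      "orthonormal_upto p p u"
      "\<forall>a<p. \<forall>b<p. S $$ (a,b) = (\<Sum>i<p. eigvals_desc S ! i * u i a * u i b)"
      by (rule spectral_decomposition[OF symX])
    have form: "ip p x (mv p (\<lambda>a b. S $$ (a,b)) x) = 1 / (real n - 1) *
        ((\<Sum>i<n. (ip p x (\<lambda>a. X i a - mu a))\<^sup>2) - (\<Sum>i<n. ip p x (\<lambda>a. X i a - mu a))\<^sup>2 / n)" for x
      unfolding S_def using n by (intro sample_cov_form_centered) simp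
    have "l (d - 1) / 2 \<le> eigvals_desc S ! (d - 1)"
    proof (rule eigenvalue_lower_bound[OF u(3) v(3) d(2,1) eigvals_desc_decreasing[OF symX] u(4)[rule_format]])
      fix a x assume x: "x = (\<lambda>c. \<Sum>j<d. a j * v j c)"
      \<comment> \<open>Coefficients of the trial vector in unit-variance coordinates;
        \<open>l_ge\<close> later bounds their squares below by \<open>l (d - 1)\<close> times those
        of \<open>a\<close>.\<close>
      define b where "b j = a j * sqrt (l j)" for j
      have h: "ip p x (\<lambda>c. X i c - mu c) = (\<Sum>j<d. b j * Y i j)" for i
        unfolding x ip_sum_left ip_scale_left using d by (simp add: ve b_def Y_def mult.assoc)
      have gram: "n * (\<Sum>j<d. (b j)\<^sup>2) / 2
          \<le> (\<Sum>i<n. (\<Sum>j<d. b j * Y i j)\<^sup>2) - (\<Sum>i<n. \<Sum>j<d. b j * Y i j)\<^sup>2 / n"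
      proof (rule empirical_gram_lower_bound)
        show "\<bar>\<Sum>i<n. Y i j * Y i k - (if j = k then 1 else 0)\<bar> \<le> 1 / (4 * real d) * n"
          if "j < d" "k < d" for j k
        proof -
          have "X \<notin> E (j, k)" using X that by (auto simp: B_def)
          thus ?thesis using X by (simp add: E_def Y_def eps_def)
        qed
        show "\<bar>\<Sum>i<n. Y i j\<bar> \<le> 1 / (4 * real d) * n" if "j < d" for j
        proof -
          have "X \<notin> F j" using X that by (auto simp: B_def)
          thus ?thesis using X by (simp add: F_def Y_def eps_def)
        qed
      qed (use n d in auto)
      have "l (d - 1) / 2 * (\<Sum>j<d. (a j)\<^sup>2) \<le> (\<Sum>j<d. (b j)\<^sup>2) / 2"
      proof -
        have "l (d - 1) * (\<Sum>j<d. (a j)\<^sup>2) \<le> (\<Sum>j<d. l j * (a j)\<^sup>2)"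
          unfolding sum_distrib_left by (intro sum_mono mult_right_mono l_ge) auto
        also have "\<dots> = (\<Sum>j<d. (b j)\<^sup>2)"
          using d by (intro sum.cong refl) (auto simp: b_def power_mult_distrib l_pos less_imp_le mult.commute)
        finally show ?thesis by simp
      qed
      also have "\<dots> \<le> 1 / (real n - 1) * (n * (\<Sum>j<d. (b j)\<^sup>2) / 2)"
      proof -
        have "1 \<le> n / (real n - 1)" using n by simp
        hence "1 * ((\<Sum>j<d. (b j)\<^sup>2) / 2) \<le> n / (real n - 1) * ((\<Sum>j<d. (b j)\<^sup>2) / 2)"
          by (intro mult_right_mono) (auto intro!: sum_nonneg)
        thus ?thesis by simp
      qed
      also have "\<dots> \<le> ip p x (mv p (\<lambda>a b. S $$ (a,b)) x)"
        unfolding form h using n by (intro mult_left_mono gram) auto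
      finally show "l (d - 1) / 2 * (\<Sum>j<d. (a j)\<^sup>2) \<le> ip p x (mv p (\<lambda>a b. S $$ (a,b)) x)" .
    qed
    moreover have "(\<Sum>i\<in>{d..<p}. eigvals_desc S ! i) \<le> 2 * s2 * K * p"
    proof -
      have "(\<Sum>i\<in>{d..<p}. eigvals_desc S ! i) \<le> (\<Sum>j\<in>{d..<p}. ip p (v j) (mv p (\<lambda>a b. S $$ (a,b)) (v j)))"
        by (rule tail_eigenvalue_sum_le_trace[OF u(3) v(3) d(2) eigvals_desc_decreasing[OF symX] u(4)[rule_format]])
      also have "\<dots> \<le> (\<Sum>j\<in>{d..<p}. 1 / (real n - 1) * (\<Sum>i<n. s2 * (Y i j)\<^sup>2))"
      proof (rule sum_mono)
        fix j assume j: "j \<in> {d..<p}"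
        have "(ip p (v j) (\<lambda>a. X i a - mu a))\<^sup>2 = s2 * (Y i j)\<^sup>2" for i
          using j bulk l_pos[of j] by (simp add: ve power_mult_distrib Y_def l_def)
        thus "ip p (v j) (mv p (\<lambda>a b. S $$ (a,b)) (v j)) \<le> 1 / (real n - 1) * (\<Sum>i<n. s2 * (Y i j)\<^sup>2)"
          unfolding form using n by (intro mult_left_mono) auto
      qed
      also have "\<dots> = s2 / (real n - 1) * Z X"
        unfolding Z_def Y_def by (subst sum.swap) (simp add: sum_distrib_left sum_divide_distrib)
      also have "\<dots> \<le> s2 / (real n - 1) * (K * n * p)"
      proof (intro mult_left_mono)
        have "X \<notin> G" using X by (auto simp: B_def)
        thus "Z X \<le> K * n * p" using X by (simp add: G_def)
      qed (use n bulk(2) in auto)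
      also have "\<dots> = (n / (real n - 1)) * (s2 * K * p)" by simp
      \<comment> \<open>The factor 2 bounds \<open>n / (n - 1)\<close> for
        \<open>n \<ge> 2\<close>.\<close>
      also have "\<dots> \<le> 2 * (s2 * K * p)"
        using n bulk(2) K by (intro mult_right_mono) (auto simp: field_simps)
      finally show ?thesis by simp
    qed
    ultimately show ?thesis by (simp add: S_def)
  qed
  show ?thesis unfolding sample_measure_eq using Bs Bm good by (intro bexI[of _ B]) (auto simp: l_def)
qed

end

text \<open>Deterministic. With \<open>s\<close> the sum of the top values still present and
  \<open>b\<close> the tail sum, the sum of squares is at least \<open>s\<^sup>2 / d\<close>, and
  \<open>s / (s + b)\<close> increases in \<open>s\<close> and decreases in \<open>b\<close>. One
  lower bound for a spiked value and one upper bound for the tail can thus be inserted.\<close>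

lemma T_stat_lower_bound:
  assumes k: "k < d" "d \<le> p" and L: "0 < Lb" "Lb \<le> eigvals_desc (sample_cov n p X) ! (d - 1)"
    and C: "(\<Sum>i\<in>{d..<p}. eigvals_desc (sample_cov n p X) ! i) \<le> Cb"
  shows "(real p - real k) / d * (Lb / (Lb + Cb))\<^sup>2 - 1 \<le> T_stat n p X k"
proof -
  define f where "f i = eigvals_desc (sample_cov n p X) ! i" for i
  have dim: "dim_row (sample_cov n p X) = p" by (simp add: sample_cov_def)
  have f0: "0 \<le> f i" if "i < p" for i
    unfolding f_def by (rule eigvals_desc_nonneg[OF sample_cov_sym sample_cov_psd that])
  define s where "s = (\<Sum>i\<in>{k..<d}. f i)"
  define b where "b = (\<Sum>i\<in>{d..<p}. f i)"
  define r where "r = real p - real k"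
  have r: "r > 0" "real (p - k) = r" using k by (auto simp: r_def)
  \<comment> \<open>Since \<open>k < d\<close>, the smallest spiked value is never removed, and it
    alone bounds \<open>s\<close> from below.\<close>
  have "f (d - 1) \<le> s" unfolding s_def using k by (intro member_le_sum f0) auto
  hence Ls: "Lb \<le> s" using L by (simp add: f_def)
  have b0: "0 \<le> b" unfolding b_def by (intro sum_nonneg f0) auto
  have bC: "b \<le> Cb" using C by (simp add: b_def f_def)
  have split: "(\<Sum>i\<in>{k..<p}. g i) = (\<Sum>i\<in>{k..<d}. g i) + (\<Sum>i\<in>{d..<p}. g i)" for g :: "nat \<Rightarrow> real"
    using k by (intro sum.atLeastLessThan_concat[symmetric]) auto
  have sq: "s\<^sup>2 / d \<le> (\<Sum>i\<in>{k..<p}. (f i)\<^sup>2)"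
  proof -
    have "s\<^sup>2 \<le> (\<Sum>i\<in>{k..<d}. (f i)\<^sup>2) * card {k..<d}"
      unfolding s_def by (rule sum_squared_le_sum_of_squares)
    also have "\<dots> \<le> (\<Sum>i\<in>{k..<p}. (f i)\<^sup>2) * d"
      unfolding split by (intro mult_mono) (auto intro!: sum_nonneg add_nonneg_nonneg)
    finally show ?thesis using k by (simp add: field_simps)
  qed
  have "T_stat n p X k = ((1 / r) * (\<Sum>i\<in>{k..<p}. (f i)\<^sup>2)) / ((1 / r) * (s + b))\<^sup>2 - 1"
    unfolding T_stat_def Let_def moment_small_def dim r(2) f_def[symmetric]
    using k by (simp add: split[of f] s_def b_def)
  also have "((1 / r) * (\<Sum>i\<in>{k..<p}. (f i)\<^sup>2)) / ((1 / r) * (s + b))\<^sup>2 = r * (\<Sum>i\<in>{k..<p}. (f i)\<^sup>2) / (s + b)\<^sup>2"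
    using r by (simp add: power2_eq_square)
  finally have T: "T_stat n p X k = r * (\<Sum>i\<in>{k..<p}. (f i)\<^sup>2) / (s + b)\<^sup>2 - 1" .
  have "Lb / (Lb + Cb) \<le> s / (s + b)"
  proof -
    have "Lb * b \<le> s * Cb" using Ls bC b0 L by (intro mult_mono) auto
    thus ?thesis using Ls bC b0 L by (simp add: divide_simps) (simp add: algebra_simps)
  qed
  moreover have "0 \<le> Lb / (Lb + Cb)" using L bC b0 by simp
  ultimately have "(Lb / (Lb + Cb))\<^sup>2 \<le> (s / (s + b))\<^sup>2" by (rule power_mono)
  hence "r / d * (Lb / (Lb + Cb))\<^sup>2 \<le> r / d * (s / (s + b))\<^sup>2"
    using r by (intro mult_left_mono) auto
  also have "\<dots> = r * (s\<^sup>2 / d) / (s + b)\<^sup>2" by (simp add: power_divide)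
  also have "\<dots> \<le> r * (\<Sum>i\<in>{k..<p}. (f i)\<^sup>2) / (s + b)\<^sup>2"
    using r sq by (intro divide_right_mono mult_left_mono) auto
  finally show ?thesis unfolding T r_def by simp
qed

section \<open>Divergence of the statistic\<close>

text \<open>The inequality \<open>(x + y)\<^sup>2 \<le> 2 * (x\<^sup>2 + y\<^sup>2)\<close> costs
  one factor 2 and \<open>p / 2 \<le> r\<close> the other. The reciprocal form separates
  \<open>1 / p\<close> from \<open>p / L\<^sup>2\<close>, whose behaviour can be read off the
  hypotheses.\<close>

lemma ratio_square_lower_bound:
  fixes L c d p r :: real
  assumes "0 < L" "0 \<le> c" "0 < d" "0 < p" "p / 2 \<le> r"
  shows "1 / (4 * d * (1 / p + c\<^sup>2 * (p / L\<^sup>2))) \<le> r / d * (L / (L + c * p))\<^sup>2"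
proof -
  have "0 \<le> (L - c * p)\<^sup>2" by simp
  hence "(L + c * p)\<^sup>2 \<le> 2 * (L\<^sup>2 + c\<^sup>2 * p\<^sup>2)" by (simp add: power2_eq_square algebra_simps)
  moreover have pos: "0 < (L + c * p)\<^sup>2" using assms by (intro zero_less_power) (simp add: add_pos_nonneg)
  moreover have "0 < L\<^sup>2 + c\<^sup>2 * p\<^sup>2" using assms by (simp add: add_pos_nonneg)
  ultimately have "L\<^sup>2 / (2 * (L\<^sup>2 + c\<^sup>2 * p\<^sup>2)) \<le> L\<^sup>2 / (L + c * p)\<^sup>2"
    by (intro divide_left_mono mult_pos_pos) auto
  also have "\<dots> = (L / (L + c * p))\<^sup>2" by (simp add: power_divide)
  finally have 1: "L\<^sup>2 / (2 * (L\<^sup>2 + c\<^sup>2 * p\<^sup>2)) \<le> (L / (L + c * p))\<^sup>2" .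
  have "1 / p + c\<^sup>2 * (p / L\<^sup>2) = (L\<^sup>2 + c\<^sup>2 * p\<^sup>2) / (p * L\<^sup>2)"
    using assms by (simp add: field_simps power2_eq_square)
  hence "1 / (4 * d * (1 / p + c\<^sup>2 * (p / L\<^sup>2))) = (p / 2) / d * (L\<^sup>2 / (2 * (L\<^sup>2 + c\<^sup>2 * p\<^sup>2)))"
    by simp
  also have "\<dots> \<le> r / d * (L / (L + c * p))\<^sup>2"
    using assms 1 by (intro mult_mono divide_right_mono) auto
  finally show ?thesis .
qed

text \<open>With \<open>q\<close> the lower bound for \<open>T + 1\<close>, both \<open>1 / q\<close> and \<open>(p / n) / q\<close> tend to zero in
  either regime.\<close>

lemma statistic_bound_diverges:
  fixes p :: "nat \<Rightarrow> nat" and l :: "nat \<Rightarrow> real" and c M :: real and d k :: nat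
  assumes p_inf: "filterlim p at_top sequentially" and l_pos: "\<And>n. 0 < l n" and "0 \<le> c" "1 \<le> d"
    and regime:
      "(\<exists>\<gamma>. (\<lambda>n. real (p n) / real n) \<longlonglongrightarrow> \<gamma> \<and> (\<lambda>n. real (p n) / (l n)\<^sup>2) \<longlonglongrightarrow> 0)
       \<or> (filterlim (\<lambda>n. real (p n) / real n) at_top sequentially \<and>
          (\<lambda>n. real (p n) / (sqrt (real n) * l n)) \<longlonglongrightarrow> 0)"
  shows "\<forall>\<^sub>F n in sequentially.
    M < ((real n - real k - 1) * ((real (p n) - real k) / d * (l n / (l n + c * p n))\<^sup>2 - 1)
        - (real (p n) - real k)) / n"
proof -
  define w where "w n = 4 * real d * (1 / p n + c\<^sup>2 * (p n / (l n)\<^sup>2))" for n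
  have p_inf': "filterlim (\<lambda>n. real (p n)) at_top sequentially"
    using filterlim_compose[OF filterlim_real_sequentially p_inf] .
  have inv_p: "(\<lambda>n. 1 / real (p n)) \<longlonglongrightarrow> 0"
    using tendsto_inverse_0_at_top[OF p_inf'] by (simp add: inverse_eq_divide)
  have p_pos: "\<forall>\<^sub>F n in sequentially. 0 < p n"
    using p_inf by (metis eventually_gt_at_top filterlim_iff)
  have w_pos: "\<forall>\<^sub>F n in sequentially. 0 < w n"
    using p_pos
  proof eventually_elim
    case (elim n)
    thus ?case unfolding w_def using \<open>1 \<le> d\<close> by (intro mult_pos_pos add_pos_nonneg) auto
  qed
  \<comment> \<open>What is wanted in the end is \<open>M < (q - 1) / 2 - p / n\<close>, with
    \<open>q\<close> the bound for \<open>T + 1\<close>; the 3 leaves a slack of one.\<close>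
  have key: "\<forall>\<^sub>F n in sequentially. 2 * (real (p n) / n) + 2 * \<bar>M\<bar> + 3 \<le> 1 / w n"
    using regime
  proof
    assume "\<exists>\<gamma>. (\<lambda>n. real (p n) / real n) \<longlonglongrightarrow> \<gamma> \<and> (\<lambda>n. real (p n) / (l n)\<^sup>2) \<longlonglongrightarrow> 0"
    then obtain \<gamma> where g: "(\<lambda>n. real (p n) / real n) \<longlonglongrightarrow> \<gamma>" "(\<lambda>n. real (p n) / (l n)\<^sup>2) \<longlonglongrightarrow> 0" by blast
    have "(\<lambda>n. w n * (2 * (real (p n) / n) + 2 * \<bar>M\<bar> + 3))
        \<longlonglongrightarrow> 4 * real d * (0 + c\<^sup>2 * 0) * (2 * \<gamma> + 2 * \<bar>M\<bar> + 3)"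
      unfolding w_def by (intro tendsto_intros inv_p g)
    hence "\<forall>\<^sub>F n in sequentially. w n * (2 * (real (p n) / n) + 2 * \<bar>M\<bar> + 3) < 1"
      by (intro order_tendstoD(2)) auto
    thus ?thesis using w_pos
      by eventually_elim (simp add: field_simps)
  next
    assume A: "filterlim (\<lambda>n. real (p n) / real n) at_top sequentially \<and>
          (\<lambda>n. real (p n) / (sqrt (real n) * l n)) \<longlonglongrightarrow> 0"
    have inv_n: "(\<lambda>n. 1 / real n) \<longlonglongrightarrow> 0" by (rule lim_1_over_n)
    \<comment> \<open>This is \<open>w n * (p n / n)\<close>: the factor \<open>p / n\<close> turns
      \<open>1 / p\<close> into \<open>1 / n\<close> and \<open>p / l\<^sup>2\<close> into the
      square of the ratio assumed to vanish. A value below 1/4 gives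
      \<open>4 * p / n \<le> 1 / w n\<close>; half covers \<open>2 * p / n\<close>, and since
      \<open>p / n\<close> diverges the other half covers the constants.\<close>
    have "(\<lambda>n. 4 * real d * (1 / real n + c\<^sup>2 * (real (p n) / (sqrt (real n) * l n))\<^sup>2))
        \<longlonglongrightarrow> 4 * real d * (0 + c\<^sup>2 * 0\<^sup>2)"
      using A by (intro tendsto_intros inv_n) auto
    hence "\<forall>\<^sub>F n in sequentially. 4 * real d * (1 / real n + c\<^sup>2 * (real (p n) / (sqrt (real n) * l n))\<^sup>2) < 1/4"
      by (intro order_tendstoD(2)) auto
    moreover have "\<forall>\<^sub>F n in sequentially. 2 * \<bar>M\<bar> + 3 \<le> real (p n) / n"
      using A by (simp add: filterlim_at_top)
    ultimately show ?thesis using w_pos p_pos eventually_gt_at_top[of 0]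
    proof eventually_elim
      case (elim n)
      have "w n * (real (p n) / n) = 4 * real d * (1 / real n + c\<^sup>2 * (real (p n) / (sqrt (real n) * l n))\<^sup>2)"
        using elim(4,5) l_pos[of n] by (simp add: w_def power_divide power_mult_distrib field_simps power2_eq_square)
      hence "w n * (real (p n) / n) < 1/4" using elim(1) by simp
      hence "4 * (real (p n) / n) \<le> 1 / w n" using elim(3) by (simp add: field_simps)
      thus ?case using elim(2) by linarith
    qed
  qed
  have "\<forall>\<^sub>F n in sequentially. real (2 * k) \<le> real (p n)"
    using p_inf' unfolding filterlim_at_top by blast
  with key p_pos eventually_ge_at_top[of "2 * k + 2"] show ?thesis
  proof eventually_elim
    case (elim n)
    define q where "q = (real (p n) - real k) / d * (l n / (l n + c * p n))\<^sup>2"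
    have "1 / w n \<le> q" unfolding w_def q_def
      using elim \<open>1 \<le> d\<close> \<open>0 \<le> c\<close> l_pos by (intro ratio_square_lower_bound) auto
    hence q: "2 * (real (p n) / n) + 2 * \<bar>M\<bar> + 3 \<le> q" using elim(1) by linarith
    moreover have "0 \<le> real (p n) / n" by simp
    ultimately have "0 \<le> q - 1" by linarith
    \<comment> \<open>From \<open>n \<ge> 2 * k + 2\<close> the factor \<open>n - k - 1\<close> is
      at least \<open>n / 2\<close>.\<close>
    have "n * (q - 1) / 2 \<le> (real n - real k - 1) * (q - 1)"
      using mult_right_mono[OF _ \<open>0 \<le> q - 1\<close>, of "n / 2" "real n - real k - 1"] elim(3) by simp
    hence "(n * (q - 1) / 2 - real (p n)) / n \<le> ((real n - real k - 1) * (q - 1) - (real (p n) - real k)) / n"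
      by (intro divide_right_mono) auto
    moreover have "(n * (q - 1) / 2 - real (p n)) / n = (q - 1) / 2 - real (p n) / n"
      using elim(3) by (simp add: field_simps)
    moreover have "M < (q - 1) / 2 - real (p n) / n" using q abs_ge_self[of M] by argo
    ultimately show ?case unfolding q_def[symmetric] by linarith
  qed
qed

text \<open>Eventually the event lies inside the exceptional set of
  \<open>sample_concentration\<close>: off that set \<open>T_stat_lower_bound\<close> and
  \<open>statistic_bound_diverges\<close> push the statistic above \<open>M\<close>.\<close>

theorem theorem2:
  fixes p :: "nat \<Rightarrow> nat"
    and mu :: "nat \<Rightarrow> nat \<Rightarrow> real"
    and Sig :: "nat \<Rightarrow> real mat"
    and d :: nat and sigma2 :: real
    and lam :: "nat \<Rightarrow> nat \<Rightarrow> real"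
  assumes p_inf: "filterlim (\<lambda>n. p n) at_top sequentially"
    and Sigma_pd: "\<And>n. pos_def_mat (p n) (Sig n)"
    and d_pos: "d \<ge> 1"
    and d_le: "\<And>n. d \<le> p n"
    and sigma2_pos: "sigma2 > 0"
    and eig_spike: "\<And>n k. k < d \<Longrightarrow> eigvals_desc (Sig n) ! k = lam n k"
    and eig_bulk: "\<And>n k. d \<le> k \<Longrightarrow> k < p n \<Longrightarrow> eigvals_desc (Sig n) ! k = sigma2"
    and spike_gt: "\<And>n. lam n (d - 1) > sigma2"
    and spike_inf: "\<And>k. k < d \<Longrightarrow> filterlim (\<lambda>n. lam n k) at_top sequentially"
    and regime:
      "(\<exists>\<gamma>::real. \<gamma> \<ge> 0 \<and> \<gamma> \<noteq> 1 \<and>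
          (\<lambda>n. real (p n) / real n) \<longlonglongrightarrow> \<gamma> \<and>
          (\<lambda>n. real (p n) / (lam n (d - 1))\<^sup>2) \<longlonglongrightarrow> 0)
       \<or> (filterlim (\<lambda>n. real (p n) / real n) at_top sequentially \<and>
          (\<lambda>n. real (p n) / (real n * sqrt (lam n (d - 1)))) \<longlonglongrightarrow> 0 \<and>
          (\<lambda>n. real (p n) / (sqrt (real n) * lam n (d - 1))) \<longlonglongrightarrow> 0)"
  shows "\<forall>k<d. \<forall>M>0::real.
      (\<forall>n. {X \<in> space (sample_measure n (p n) (mu n) (Sig n)).
              g_stat n (p n) X k / real n \<le> M}
           \<in> sets (sample_measure n (p n) (mu n) (Sig n))) \<and>
      (\<lambda>n. measure (sample_measure n (p n) (mu n) (Sig n))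
              {X \<in> space (sample_measure n (p n) (mu n) (Sig n)).
                 g_stat n (p n) X k / real n \<le> M}) \<longlonglongrightarrow> 0"
proof (intro allI impI)
  fix k :: nat and M :: real
  assume k: "k < d" and "0 < M"
  let ?P = "\<lambda>n. sample_measure n (p n) (mu n) (Sig n)"
  let ?A = "\<lambda>n. {X \<in> space (?P n). g_stat n (p n) X k / real n \<le> M}"
  have gv: "gaussian_vector (p n) (Sig n)" for n
    using Sigma_pd by (simp add: gaussian_vector_def)
  have meas: "?A n \<in> sets (?P n)" for n
  proof -
    have [measurable]: "(\<lambda>X. g_stat n (p n) X k) \<in> borel_measurable (?P n)"
      using gaussian_vector.measurable_g_stat[OF gv] .
    show ?thesis by measurable
  qed
  \<comment> \<open>Half the smallest spike, the lower bound for the \<open>d\<close>-th sample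
    eigenvalue; the constants 4 and 2 in \<open>regime'\<close> come from it.\<close>
  define l where "l n = lam n (d - 1) / 2" for n
  have lam_pos: "0 < lam n (d - 1)" for n using spike_gt[of n] sigma2_pos by simp
  have lam_eig: "eigvals_desc (Sig n) ! (d - 1) = lam n (d - 1)" for n
    using eig_spike[of "d - 1"] d_pos by simp
  have regime': "(\<exists>\<gamma>. (\<lambda>n. real (p n) / real n) \<longlonglongrightarrow> \<gamma> \<and> (\<lambda>n. real (p n) / (l n)\<^sup>2) \<longlonglongrightarrow> 0)
       \<or> (filterlim (\<lambda>n. real (p n) / real n) at_top sequentially \<and>
          (\<lambda>n. real (p n) / (sqrt (real n) * l n)) \<longlonglongrightarrow> 0)"
  proof -
    have 1: "real (p n) / (l n)\<^sup>2 = 4 * (real (p n) / (lam n (d - 1))\<^sup>2)" for n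
      by (simp add: l_def power_divide)
    have 2: "real (p n) / (sqrt (real n) * l n) = 2 * (real (p n) / (sqrt (real n) * lam n (d - 1)))" for n
      by (simp add: l_def)
    have "(\<lambda>n. c * f n) \<longlonglongrightarrow> 0" if "f \<longlonglongrightarrow> 0" for c and f :: "nat \<Rightarrow> real"
      using that by (rule tendsto_mult_right_zero)
    with regime show ?thesis unfolding 1 2 by blast
  qed
  have "(\<lambda>n. measure (?P n) (?A n)) \<longlonglongrightarrow> 0"
  proof (rule order_tendstoI)
    show "\<forall>\<^sub>F n in sequentially. a < measure (?P n) (?A n)" if "a < 0" for a
      using that by (auto intro!: always_eventually less_le_trans[OF that])
    fix \<eta> :: real assume "0 < \<eta>"
    \<comment> \<open>Markov gets one half of \<open>\<eta>\<close>, and for large \<open>n\<close>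
      the Chebyshev terms \<open>D / n\<close> fit into the other half.\<close>
    define K where "K = 2 / \<eta>"
    define D where "D = 48 * real d ^ 4 + 16 * real d ^ 3"
    have K: "0 < K" "1 / K = \<eta> / 2" using \<open>0 < \<eta>\<close> by (simp_all add: K_def)
    have "\<forall>\<^sub>F n in sequentially.
        M < ((real n - real k - 1) * ((real (p n) - real k) / d * (l n / (l n + (2 * sigma2 * K) * p n))\<^sup>2 - 1)
        - (real (p n) - real k)) / n"
      by (rule statistic_bound_diverges[OF p_inf _ _ d_pos regime'])
         (use lam_pos sigma2_pos K in \<open>auto simp: l_def\<close>)
    moreover have "\<forall>\<^sub>F n in sequentially. D * (1 / real n) < \<eta> / 2"
      using tendsto_mult_right_zero[OF lim_1_over_n, of D] \<open>0 < \<eta>\<close>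
      by (intro order_tendstoD(2)) auto
    ultimately show "\<forall>\<^sub>F n in sequentially. measure (?P n) (?A n) < \<eta>"
      \<comment> \<open>Guarantees \<open>n \<ge> 2\<close> for the concentration bound and a
        nonnegative factor \<open>n - k - 1\<close> in front of \<open>T_stat\<close>.\<close>
      using eventually_ge_at_top[of "d + 2"]
    proof eventually_elim
      case (elim n)
      interpret gaussian_vector "p n" "mu n" "Sig n" by (rule gv)
      interpret prob_space "?P n"
        unfolding sample_measure_eq by (intro prob_space_PiM prob_space_mvn)
      have "\<exists>B\<in>sets (?P n). measure (?P n) B \<le> 1 / K + D / n \<and>
        (\<forall>X\<in>space (?P n) - B. lam n (d - 1) / 2 \<le> eigvals_desc (sample_cov n (p n) X) ! (d - 1) \<and>
           (\<Sum>i\<in>{d..<p n}. eigvals_desc (sample_cov n (p n) X) ! i) \<le> 2 * sigma2 * K * p n)"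
        unfolding D_def lam_eig[symmetric]
        by (rule sample_concentration) (use elim(3) d_pos d_le K lam_eig lam_pos eig_bulk sigma2_pos in auto)
      then obtain B where B: "B \<in> sets (?P n)" "measure (?P n) B \<le> 1 / K + D / n"
        "\<And>X. X \<in> space (?P n) - B \<Longrightarrow> l n \<le> eigvals_desc (sample_cov n (p n) X) ! (d - 1)"
        "\<And>X. X \<in> space (?P n) - B \<Longrightarrow>
           (\<Sum>i\<in>{d..<p n}. eigvals_desc (sample_cov n (p n) X) ! i) \<le> 2 * sigma2 * K * p n"
        unfolding l_def by blast
      have "?A n \<subseteq> B"
      proof (rule ccontr)
        assume "\<not> ?A n \<subseteq> B"
        then obtain X where X: "X \<in> space (?P n) - B" "g_stat n (p n) X k / real n \<le> M" by blast
        have "(real (p n) - real k) / d * (l n / (l n + 2 * sigma2 * K * p n))\<^sup>2 - 1 \<le> T_stat n (p n) X k"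
          using k d_le lam_pos B(3,4)[OF X(1)] by (intro T_stat_lower_bound) (auto simp: l_def)
        hence "((real n - real k - 1) * ((real (p n) - real k) / d * (l n / (l n + 2 * sigma2 * K * p n))\<^sup>2 - 1)
            - (real (p n) - real k)) / n \<le> g_stat n (p n) X k / real n"
          unfolding g_stat_def using elim(3) k by (intro divide_right_mono diff_right_mono mult_left_mono) auto
        with X(2) elim(1) show False by simp
      qed
      hence "measure (?P n) (?A n) \<le> measure (?P n) B" using B(1) by (intro finite_measure_mono)
      also have "\<dots> \<le> \<eta> / 2 + D * (1 / real n)" using B(2) K(2) by simp
      also have "\<dots> < \<eta>" using elim(2) by linarith
      finally show ?case .
    qed
  qed
  with meas show "(\<forall>n. ?A n \<in> sets (?P n)) \<and> (\<lambda>n. measure (?P n) (?A n)) \<longlonglongrightarrow> 0" by blast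
qed

end
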